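(* Consider, for every $m\in\mathbb{N}$, the model $y_m=A_mx_m^*+\varepsilon_m$ with $A_m\in\mathbb{R}^{m\times m}$ and $\varepsilon_m\sim\mathcal{N}(0,\sigma^2I_m)$, where $\sigma^2>0$ does not depend on $m$, and suppose that the singular values of $A_m$ satisfy $1=\gamma_{1,m}\ge\gamma_{2,m}\ge\dots\ge\gamma_{m,m}\ge 0$. Then for any sequence of vectors $(x_m^* )_{m\in\mathbb{N}}$, $x_m^*\in\mathbb{R}^m$, such that $\|x_m^*\|_2^2=O(m)$, we have, as $m\to\infty$, $$\sup_{\alpha\in[0,\infty)}\Bigl|\frac1m\bigl(\mathrm{PSURE}_m(\alpha,y_m)-\mathrm{MSPE}_m(\alpha)\bigr)\Bigr|=O_{\mathbb{P}}\Bigl(\frac{1}{\sqrt m}\Bigr)$$ and $$\mathbb{E}\Biggl[\biggl(\sup_{\alpha\in[0,\infty)}\Bigl|\frac1m\bigl(\mathrm{PSURE}_m(\alpha,y_m)-\mathrm{MSPE}_m(\alpha)\bigr)\Bigr|\biggr)^2\Biggr]=O\Bigl(\frac1m\Bigr).$$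
   Context: Tikhonov estimator: for $\alpha>0$, $\hat x_\alpha(y)=(A_m^{T}A_m+\alpha I)^{-1}A_m^{T}y$; for $\alpha=0$ all quantities are understood as limits $\alpha\downarrow0$ (so $\hat x_0(y)=A_m^{+}y$ with $A_m^+$ the Moore–Penrose pseudoinverse). Mean squared prediction error: $\mathrm{MSPE}_m(\alpha)=\mathbb{E}\bigl[\|A_m(x_m^*-\hat x_\alpha(y_m))\|_2^2\bigr]$. Risk estimator: $$\mathrm{PSURE}_m(\alpha,y)=\|y-A_m\hat x_\alpha(y)\|_2^2-m\sigma^2+2\sigma^2\,\mathrm{tr}\bigl(A_m(A_m^{T}A_m+\alpha I)^{-1}A_m^{T}\bigr).$$ Equivalently, with a singular value decomposition $A_m=U\Sigma V^{T}$, $\Sigma=\mathrm{diag}(\gamma_{1,m},\dots,\gamma_{m,m})$, $u_i,v_i$ the columns of $U,V$, $y_i=\langle u_i,y\rangle$ and $x_{i,m}^*=\langle v_i,x_m^*\rangle$, $$\mathrm{PSURE}_m(\alpha,y)=\sum_{i=1}^m\frac{\alpha^2}{(\gamma_{i,m}^2+\alpha)^2}y_i^2-m\sigma^2+2\sigma^2\sum_{i=1}^m\frac{\gamma_{i,m}^2}{\gamma_{i,m}^2+\alpha},$$ and $\mathrm{MSPE}_m(\alpha)=\mathbb{E}[\mathrm{PSURE}_m(\alpha,y_m)]$ is obtained by replacing $y_i^2$ by $\gamma_{i,m}^2(x_{i,m}^* )^2+\sigma^2$. Stochastic order symbol: for random variables $Z_m$ and positive numbers $r_m$, $Z_m=O_{\mathbb{P}}(r_m)$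 means $\lim_{T\to\infty}\limsup_{m\to\infty}\mathbb{P}(|Z_m|>Tr_m)=0$. *)

theory Defs
  imports
    "HOL-Probability.Probability"
    "HOL-Library.Landau_Symbols"
    "Jordan_Normal_Form.Gauss_Jordan_Elimination"
begin

definition sqnorm :: "real Matrix.vec \<Rightarrow> real" where
  "sqnorm v = scalar_prod v v"

definition mat_trace :: "real Matrix.mat \<Rightarrow> real" where
  "mat_trace B = (\<Sum>i<dim_row B. B $$ (i, i))"

(* The JNF predicate orthogonal_mat only asks for pairwise orthogonal nonzero columns. *)
definition is_orthogonal_matrix :: "nat \<Rightarrow> real Matrix.mat \<Rightarrow> bool" where
  "is_orthogonal_matrix n U \<longleftrightarrow>
     U \<in> carrier_mat n n \<and> U * transpose_mat U = 1\<^sub>m n \<and> transpose_mat U * U = 1\<^sub>m n"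

(* Indices start at 0: g i is the (i+1)-st singular value.  The clauses on g make the
   singular values g 0, ..., g (n - 1) unique, with multiplicity. *)
definition singular_values :: "nat \<Rightarrow> real Matrix.mat \<Rightarrow> (nat \<Rightarrow> real) \<Rightarrow> bool" where
  "singular_values n B g \<longleftrightarrow>
     (\<exists>U V. is_orthogonal_matrix n U \<and> is_orthogonal_matrix n V \<and>
            B = U * mat_diag n g * transpose_mat V) \<and>
     (\<forall>i<n. 0 \<le> g i) \<and>
     (\<forall>i j. i \<le> j \<and> j < n \<longrightarrow> g j \<le> g i)"

definition tikhonov_pos :: "real Matrix.mat \<Rightarrow> real \<Rightarrow> real Matrix.mat" where
  "tikhonov_pos B \<alpha> =
     the (mat_inverse (transpose_mat B * B + \<alpha> \<cdot>\<^sub>m 1\<^sub>m (dim_col B))) * transpose_mat B"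

(* At \<alpha> = 0 this is the entrywise limit for \<alpha> decreasing to 0, i.e. the Moore-Penrose
   pseudoinverse.  The estimator, the trace and the risks below are continuous in the
   entries of this matrix, so their values at \<alpha> = 0 are the corresponding limits too. *)
definition tikhonov_matrix :: "real Matrix.mat \<Rightarrow> real \<Rightarrow> real Matrix.mat" where
  "tikhonov_matrix B \<alpha> =
     (if \<alpha> = 0
      then Matrix.mat (dim_col B) (dim_row B)
             (\<lambda>ij. Lim (at_right 0) (\<lambda>\<beta>. tikhonov_pos B \<beta> $$ ij))
      else tikhonov_pos B \<alpha>)"

definition tikhonov :: "real Matrix.mat \<Rightarrow> real \<Rightarrow> real Matrix.vec \<Rightarrow> real Matrix.vec" where
  "tikhonov B \<alpha> y = tikhonov_matrix B \<alpha> *\<^sub>v y"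

definition MSPE ::
  "'w measure \<Rightarrow> real Matrix.mat \<Rightarrow> real Matrix.vec \<Rightarrow> ('w \<Rightarrow> real Matrix.vec) \<Rightarrow> real \<Rightarrow> real"
where
  "MSPE P B x Y \<alpha> = (LINT \<omega>|P. sqnorm (B *\<^sub>v (x - tikhonov B \<alpha> (Y \<omega>))))"

definition PSURE ::
  "real \<Rightarrow> real Matrix.mat \<Rightarrow> real \<Rightarrow> real Matrix.vec \<Rightarrow> real"
where
  "PSURE \<sigma> B \<alpha> y =
     sqnorm (y - B *\<^sub>v tikhonov B \<alpha> y) - real (dim_row B) * \<sigma>\<^sup>2
       + 2 * \<sigma>\<^sup>2 * mat_trace (B * tikhonov_matrix B \<alpha>)"

(* A random vector with law N(0, \<sigma>^2 I_n): independent coordinates, each N(0, \<sigma>^2);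
   the second argument of normal_density is the standard deviation. *)
definition white_noise :: "'w measure \<Rightarrow> nat \<Rightarrow> real \<Rightarrow> ('w \<Rightarrow> real Matrix.vec) \<Rightarrow> bool" where
  "white_noise P n \<sigma> e \<longleftrightarrow>
     (\<forall>\<omega>\<in>space P. e \<omega> \<in> carrier_vec n) \<and>
     prob_space.indep_vars P (\<lambda>_. borel) (\<lambda>i \<omega>. vec_index (e \<omega>) i) {..<n} \<and>
     (\<forall>i<n. distributed P lborel (\<lambda>\<omega>. vec_index (e \<omega>) i) (\<lambda>t. ennreal (normal_density 0 \<sigma> t)))"

(* Each Z m may live on its own probability space P m. *)
definition bigO_prob ::
  "(nat \<Rightarrow> 'w measure) \<Rightarrow> (nat \<Rightarrow> 'w \<Rightarrow> real) \<Rightarrow> (nat \<Rightarrow> real) \<Rightarrow> bool"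
where
  "bigO_prob P Z r \<longleftrightarrow>
     ((\<lambda>T. limsup (\<lambda>m. ereal (measure (P m) {\<omega> \<in> space (P m). \<bar>Z m \<omega>\<bar> > T * r m})))
        \<longlongrightarrow> 0) at_top"

definition risk_gap ::
  "'w measure \<Rightarrow> nat \<Rightarrow> real \<Rightarrow> real Matrix.mat \<Rightarrow> real Matrix.vec \<Rightarrow> ('w \<Rightarrow> real Matrix.vec) \<Rightarrow>
   real \<Rightarrow> 'w \<Rightarrow> real"
where
  "risk_gap P m \<sigma> B x Y \<alpha> \<omega> = \<bar>1 / real m * (PSURE \<sigma> B \<alpha> (Y \<omega>) - MSPE P B x Y \<alpha>)\<bar>"

(* SUP on the reals is meaningful only for a set that is bounded above, and LINT only for an
   integrable function: statements about this supremum have to assert both separately. *)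
definition sup_risk_gap ::
  "'w measure \<Rightarrow> nat \<Rightarrow> real \<Rightarrow> real Matrix.mat \<Rightarrow> real Matrix.vec \<Rightarrow> ('w \<Rightarrow> real Matrix.vec) \<Rightarrow>
   'w \<Rightarrow> real"
where
  "sup_risk_gap P m \<sigma> B x Y \<omega> = (SUP \<alpha>\<in>{0..}. risk_gap P m \<sigma> B x Y \<alpha> \<omega>)"

end

theory Submission
  imports Defs
begin

text \<open>
  In the coordinates of a singular value decomposition, let \<open>b i\<close> be the signal and \<open>z i\<close> the rotated
  noise, which is again white. The difference \<open>PSURE - MSPE\<close> equals \<open>\<Sum>i. w i * X i\<close> with
  \<open>X i = 2 * b i * z i + (z i)\<^sup>2 - \<sigma>\<^sup>2\<close> independent and centred, and
  \<open>w i = (\<alpha> / ((\<gamma> i)\<^sup>2 + \<alpha>))\<^sup>2\<close>. As the singular values decrease, the weights increase in \<open>i\<close> and lie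
  in \<open>[0, 1]\<close> for every \<open>\<alpha>\<close>, so by Abel summation the supremum over \<open>\<alpha>\<close> is at most twice the maximal
  partial sum of the \<open>X i\<close>. Doob's \<open>L\<^sup>2\<close> inequality bounds its second moment by four times the total
  variance, which is \<open>O(m)\<close>. The supremum over \<open>\<alpha>\<close> is measurable because by continuity it can be taken
  over rational \<open>\<alpha>\<close>; the stochastic order follows from Chebyshev's inequality.

  Independence of the rotated noise is obtained from the factorisation of the joint characteristic
  function, using only the one-dimensional uniqueness theorem.
\<close>

unbundle no vec_syntax

section \<open>Maximal partial sums\<close>

text \<open>Summation by parts turns the weighted sum into the last weight times the full sum, minus
  the weight increments times the earlier partial sums. The increments are nonnegative and telescope
  to at most the last weight, so both pieces are at most \<open>B\<close>. The bound is the same for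
  all monotone weights in [0, 1], which later makes it uniform in \<alpha>.\<close>

lemma Abel_summation_bound:
  fixes w X :: "nat \<Rightarrow> real"
  assumes w: "\<And>i j. i \<le> j \<Longrightarrow> j < n \<Longrightarrow> w i \<le> w j" "\<And>i. i < n \<Longrightarrow> 0 \<le> w i" "\<And>i. i < n \<Longrightarrow> w i \<le> 1"
    and S: "\<And>k. k \<le> n \<Longrightarrow> \<bar>\<Sum>i<k. X i\<bar> \<le> B"
  shows "\<bar>\<Sum>i<n. w i * X i\<bar> \<le> 2 * B"
proof (cases n)
  case 0
  with S[of 0] show ?thesis by simp
next
  case (Suc m)
  have B0: "0 \<le> B" using S[of 0] by simp
  \<comment> \<open>The quantity in bars is, up to sign, the accumulated sum of weight increments
    times partial sums; it vanishes at \<open>k = 0\<close>, and each step adds at most the new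
    increment times \<open>B\<close>.\<close>
  have "\<bar>(\<Sum>i<Suc k. w i * X i) - w k * (\<Sum>i<Suc k. X i)\<bar> \<le> w k * B" if "k \<le> m" for k
    using that
  proof (induction k)
    case 0
    show ?case using w(2)[of 0] B0 Suc by simp
  next
    case (Suc k)
    define s where "s = (\<Sum>i<Suc k. X i)"
    define a where "a = (\<Sum>i<Suc k. w i * X i)"
    have sB: "\<bar>s\<bar> \<le> B" using S[of "Suc k"] Suc.prems \<open>n = Suc m\<close> unfolding s_def by simp
    have d: "0 \<le> w (Suc k) - w k" using w(1)[of k "Suc k"] Suc.prems \<open>n = Suc m\<close> by simp
    have "(\<Sum>i<Suc (Suc k). w i * X i) - w (Suc k) * (\<Sum>i<Suc (Suc k). X i)
        = (a - w k * s) - (w (Suc k) - w k) * s"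
      unfolding sum.lessThan_Suc[of _ "Suc k"] a_def[symmetric] s_def[symmetric]
      by (simp add: algebra_simps)
    also have "\<bar>\<dots>\<bar> \<le> \<bar>a - w k * s\<bar> + (w (Suc k) - w k) * \<bar>s\<bar>"
      using abs_triangle_ineq4[of "a - w k * s" "(w (Suc k) - w k) * s"] d
      by (simp add: abs_mult)
    also have "\<dots> \<le> w k * B + (w (Suc k) - w k) * B"
      using Suc.IH Suc.prems mult_left_mono[OF sB d] unfolding a_def s_def by simp
    finally show ?case by (simp add: algebra_simps)
  qed
  from this[of m] Suc have 1: "\<bar>(\<Sum>i<n. w i * X i) - w m * (\<Sum>i<n. X i)\<bar> \<le> w m * B" by simp
  have 2: "\<bar>w m * (\<Sum>i<n. X i)\<bar> \<le> w m * B"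
    using S[of n] w(2)[of m] Suc by (simp add: abs_mult mult_left_mono)
  have 3: "w m * B \<le> B" using w(3)[of m] Suc B0 mult_right_mono[of "w m" 1 B] by simp
  from 1 2 3 show ?thesis by linarith
qed

text \<open>The range starts at the empty sum, so the maximum is over a nonempty set and is
  nonnegative. It acts on plain sequences, so that the maximal inequality can be proved path by
  path.\<close>

definition partial_max :: "(nat \<Rightarrow> real) \<Rightarrow> nat \<Rightarrow> real" where
  "partial_max X n = Max ((\<lambda>k. \<bar>\<Sum>i<k. X i\<bar>) ` {..n})"

lemma partial_max_ge: "k \<le> n \<Longrightarrow> \<bar>\<Sum>i<k. X i\<bar> \<le> partial_max X n"
  unfolding partial_max_def by (rule Max_ge) auto

lemma partial_max_nonneg: "0 \<le> partial_max X n"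
  using partial_max_ge[of 0 n X] by simp

lemma partial_max_Suc: "partial_max X (Suc n) = max (partial_max X n) \<bar>\<Sum>i<Suc n. X i\<bar>"
  unfolding partial_max_def atMost_Suc image_insert
  by (subst Max_insert) (auto simp: max.commute)

lemma partial_max_cong: "(\<And>i. i < n \<Longrightarrow> X i = Y i) \<Longrightarrow> partial_max X n = partial_max Y n"
  unfolding partial_max_def by (intro arg_cong[where f = Max] image_cong refl arg_cong[where f = abs] sum.cong) auto

text \<open>A pathwise form of Doob's inequality: the subtracted sum is a martingale transform, so it vanishes
  in expectation.\<close>
lemma pathwise_Doob_L2:
  "(partial_max X n)\<^sup>2 \<le> 4 * (\<Sum>i<n. X i)\<^sup>2
     - 4 * (\<Sum>k<n. partial_max X k * sgn (\<Sum>i<k. X i) * X k)"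
proof -
  define D where "D = (\<lambda>n. \<Sum>k<n. partial_max X k * sgn (\<Sum>i<k. X i) * X k)"
  \<comment> \<open>This form, with a product on the right, is inductive: while the maximum stays
    put, the convexity of the absolute value suffices; when the maximum jumps to the new
    \<open>\<bar>s + X n\<bar>\<close>, the square in fact 3 absorbs the change.\<close>
  have *: "(partial_max X n)\<^sup>2 / 2 + D n \<le> partial_max X n * \<bar>\<Sum>i<n. X i\<bar>"
  proof (induction n)
    case 0
    show ?case by (simp add: partial_max_def D_def)
  next
    case (Suc n)
    define M where "M = partial_max X n"
    define s where "s = (\<Sum>i<n. X i)"
    have M0: "0 \<le> M" "\<bar>s\<bar> \<le> M" by (simp_all add: M_def s_def partial_max_nonneg partial_max_ge)
    \<comment> \<open>\<open>sgn s\<close> is a subgradient of the absolute value at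
      \<open>s\<close>, also at \<open>s = 0\<close>.\<close>
    have sg: "sgn s * X n \<le> \<bar>s + X n\<bar> - \<bar>s\<bar>" by (auto simp: sgn_if abs_if)
    have "M * (sgn s * X n) \<le> M * (\<bar>s + X n\<bar> - \<bar>s\<bar>)" using M0 sg by (rule_tac mult_left_mono)
    then have 1: "D (Suc n) \<le> D n + M * (\<bar>s + X n\<bar> - \<bar>s\<bar>)"
      by (simp add: D_def M_def s_def mult.assoc)
    have "M\<^sup>2 / 2 + D n \<le> M * \<bar>s\<bar>" using Suc M_def s_def by simp
    with 1 have 2: "M\<^sup>2 / 2 + D (Suc n) \<le> M * \<bar>s + X n\<bar>" by (simp add: algebra_simps)
    have "(\<bar>s + X n\<bar> - M)\<^sup>2 \<ge> 0" by simp
    then have 3: "2 * (M * \<bar>s + X n\<bar>) \<le> \<bar>s + X n\<bar>\<^sup>2 + M\<^sup>2"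
      unfolding power2_diff by (simp add: algebra_simps)
    show ?case
    proof (cases "\<bar>s + X n\<bar> \<le> M")
      case True
      then show ?thesis using 2 by (simp add: partial_max_Suc M_def s_def)
    next
      case False
      then have "partial_max X (Suc n) = \<bar>s + X n\<bar>" by (simp add: partial_max_Suc M_def s_def)
      then show ?thesis using 2 3 by (simp add: s_def power2_eq_square)
    qed
  qed
  define M where "M = partial_max X n"
  define a where "a = \<bar>\<Sum>i<n. X i\<bar>"
  \<comment> \<open>Young's inequality weighted so that \<open>M * a\<close> costs only a quarter of
    \<open>M\<^sup>2\<close>; the other quarter remains on the left, whence Doob's constant
    4.\<close>
  have "(M - 2 * a)\<^sup>2 \<ge> 0" by simp
  then have "4 * (M * a) \<le> M\<^sup>2 + 4 * a\<^sup>2" unfolding power2_diff by (simp add: algebra_simps)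
  moreover have "M\<^sup>2 / 2 + D n \<le> M * a" using * M_def a_def by simp
  ultimately have "M\<^sup>2 \<le> 4 * a\<^sup>2 - 4 * D n" by linarith
  then show ?thesis by (simp add: M_def a_def D_def)
qed

lemma measurable_partial_max [measurable]:
  assumes [measurable]: "\<And>i. i < n \<Longrightarrow> (\<lambda>\<omega>. X \<omega> i) \<in> borel_measurable M"
  shows "(\<lambda>\<omega>. partial_max (X \<omega>) n) \<in> borel_measurable M"
  unfolding partial_max_def by (intro borel_measurable_Max borel_measurable_abs borel_measurable_sum) auto

section \<open>Doob's L2 maximal inequality for independent centred summands\<close>

context prob_space
begin

text \<open>The product space of the past consists of sequences restricted to \<open>{..<k}\<close>.
  Since \<open>f\<close> looks only at the first \<open>k\<close> entries, it takes the same value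
  on the restricted and on the full sequence, so independence of disjoint blocks applies.\<close>

lemma indep_vars_past:
  fixes X :: "nat \<Rightarrow> 'a \<Rightarrow> real" and f :: "(nat \<Rightarrow> real) \<Rightarrow> real"
  assumes ind: "indep_vars (\<lambda>_. borel) X {..<n}" and k: "k < n"
    and f: "f \<in> borel_measurable (PiM {..<k} (\<lambda>_. borel))"
    and cong: "\<And>u v. (\<And>i. i < k \<Longrightarrow> u i = v i) \<Longrightarrow> f u = f v"
  shows "indep_var borel (\<lambda>\<omega>. f (\<lambda>i. X i \<omega>)) borel (X k)"
proof -
  have "indep_var (PiM {..<k} (\<lambda>_. borel)) (\<lambda>\<omega>. restrict (\<lambda>i. X i \<omega>) {..<k})
      (PiM {k} (\<lambda>_. borel)) (\<lambda>\<omega>. restrict (\<lambda>i. X i \<omega>) {k})"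
    by (rule indep_var_restrict[OF ind]) (use k in auto)
  then have "indep_var borel (f \<circ> (\<lambda>\<omega>. restrict (\<lambda>i. X i \<omega>) {..<k}))
      borel ((\<lambda>g. g k) \<circ> (\<lambda>\<omega>. restrict (\<lambda>i. X i \<omega>) {k}))"
    by (rule indep_var_compose) (use f in auto)
  moreover have "f (restrict (\<lambda>i. X i \<omega>) {..<k}) = f (\<lambda>i. X i \<omega>)" for \<omega>
    by (rule cong) auto
  ultimately show ?thesis by (simp add: comp_def)
qed

text \<open>Take expectations in the pathwise inequality. Each term of the transform is a function
  of the past times a centred variable independent of it, hence has mean zero; the same
  orthogonality makes the second moment of the full sum equal to the sum of the variances.\<close>

lemma Kolmogorov_Doob_L2:
  fixes X :: "nat \<Rightarrow> 'a \<Rightarrow> real"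
  assumes ind: "indep_vars (\<lambda>_. borel) X {..<n}"
    and sq: "\<And>i. i < n \<Longrightarrow> integrable M (\<lambda>\<omega>. (X i \<omega>)\<^sup>2)"
    and mean: "\<And>i. i < n \<Longrightarrow> expectation (X i) = 0"
  shows "integrable M (\<lambda>\<omega>. (partial_max (\<lambda>i. X i \<omega>) n)\<^sup>2)"
    and "expectation (\<lambda>\<omega>. (partial_max (\<lambda>i. X i \<omega>) n)\<^sup>2) \<le> 4 * (\<Sum>i<n. expectation (\<lambda>\<omega>. (X i \<omega>)\<^sup>2))"
proof -
  have X[measurable]: "X i \<in> borel_measurable M" if "i < n" for i
    using ind that by (auto simp: indep_vars_def)
  have int: "integrable M (X i)" if "i < n" for i
    using square_integrable_imp_integrable[OF X[OF that] sq[OF that]] .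
  define S where "S = (\<lambda>k \<omega>. \<Sum>i<k. X i \<omega>)"
  have S_int: "integrable M (S k)" if "k \<le> n" for k
    unfolding S_def using that by (intro Bochner_Integration.integrable_sum int) auto
  have S_sq: "integrable M (\<lambda>\<omega>. (S k \<omega>)\<^sup>2)" if "k \<le> n" for k
  proof (rule Bochner_Integration.integrable_bound)
    show "integrable M (\<lambda>\<omega>. real k * (\<Sum>i<k. (X i \<omega>)\<^sup>2))"
      using that by (intro integrable_mult_right Bochner_Integration.integrable_sum sq) auto
    show "(\<lambda>\<omega>. (S k \<omega>)\<^sup>2) \<in> borel_measurable M"
      using that S_int[OF that] by (intro borel_measurable_power borel_measurable_integrable)
    \<comment> \<open>Cauchy-Schwarz provides an integrable majorant.\<close>
    have "(S k \<omega>)\<^sup>2 \<le> real k * (\<Sum>i<k. (X i \<omega>)\<^sup>2)" for \<omega>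
      using sum_squared_le_sum_of_squares[of "\<lambda>i. X i \<omega>" "{..<k}"]
      by (cases "k = 0") (auto simp: S_def mult.commute)
    then show "AE \<omega> in M. norm ((S k \<omega>)\<^sup>2) \<le> norm (real k * (\<Sum>i<k. (X i \<omega>)\<^sup>2))"
      by (auto simp: sum_nonneg)
  qed
  define PM where "PM = (\<lambda>k \<omega>. partial_max (\<lambda>i. X i \<omega>) k)"
  have PM_meas: "PM k \<in> borel_measurable M" if "k \<le> n" for k
    unfolding PM_def using that by (intro measurable_partial_max X) auto
  \<comment> \<open>A maximum of finitely many nonnegative numbers is below their sum; this crude
    bound serves only for integrability.\<close>
  have PM_le: "\<bar>PM k \<omega>\<bar> \<le> (\<Sum>j\<le>k. \<bar>S j \<omega>\<bar>)" for k \<omega>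
  proof -
    have "PM k \<omega> \<in> (\<lambda>j. \<bar>S j \<omega>\<bar>) ` {..k}"
      unfolding PM_def partial_max_def S_def by (rule Max_in) auto
    then obtain j where "j \<le> k" "PM k \<omega> = \<bar>S j \<omega>\<bar>" by auto
    then show ?thesis using member_le_sum[of j "{..k}" "\<lambda>j. \<bar>S j \<omega>\<bar>"] by simp
  qed
  have PM_int: "integrable M (PM k)" if "k \<le> n" for k
  proof (rule Bochner_Integration.integrable_bound)
    show "integrable M (\<lambda>\<omega>. \<Sum>j\<le>k. \<bar>S j \<omega>\<bar>)"
      using that by (intro Bochner_Integration.integrable_sum integrable_abs S_int) auto
  qed (use PM_le PM_meas that in \<open>auto simp: sum_nonneg\<close>)
  \<comment> \<open>For independent factors, integrability of each gives integrability of the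
    product, so a first moment of the past factor suffices.\<close>
  have orth: "integrable M (\<lambda>\<omega>. f (\<lambda>i. X i \<omega>) * X k \<omega>) \<and> expectation (\<lambda>\<omega>. f (\<lambda>i. X i \<omega>) * X k \<omega>) = 0"
    if "k < n" "f \<in> borel_measurable (PiM {..<k} (\<lambda>_. borel))"
      "\<And>u v. (\<And>i. i < k \<Longrightarrow> u i = v i) \<Longrightarrow> f u = f v" "integrable M (\<lambda>\<omega>. f (\<lambda>i. X i \<omega>))"
    for k and f :: "(nat \<Rightarrow> real) \<Rightarrow> real"
    using indep_vars_past[OF ind that(1-3)] int[OF that(1)] that(4) mean[OF that(1)]
    by (simp add: indep_var_integrable indep_var_lebesgue_integral)
  have cross: "integrable M (\<lambda>\<omega>. S k \<omega> * X k \<omega>) \<and> expectation (\<lambda>\<omega>. S k \<omega> * X k \<omega>) = 0" if "k < n" for k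
    unfolding S_def
  proof (rule orth[of k "\<lambda>u. \<Sum>i<k. u i", OF that])
    show "integrable M (\<lambda>\<omega>. \<Sum>i<k. X i \<omega>)" using S_int[of k] that by (simp add: S_def)
  qed (auto intro!: sum.cong)
  have var: "expectation (\<lambda>\<omega>. (S k \<omega>)\<^sup>2) = (\<Sum>i<k. expectation (\<lambda>\<omega>. (X i \<omega>)\<^sup>2))" if "k \<le> n" for k
    using that
  proof (induction k)
    case 0
    show ?case by (simp add: S_def)
  next
    case (Suc k)
    have "(\<lambda>\<omega>. (S (Suc k) \<omega>)\<^sup>2) = (\<lambda>\<omega>. (S k \<omega>)\<^sup>2 + 2 * (S k \<omega> * X k \<omega>) + (X k \<omega>)\<^sup>2)"
      by (simp add: S_def power2_sum algebra_simps)
    then show ?case using Suc S_sq[of k] cross[of k] sq[of k] by simp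
  qed
  have mart: "integrable M (\<lambda>\<omega>. PM k \<omega> * sgn (S k \<omega>) * X k \<omega>) \<and>
     expectation (\<lambda>\<omega>. PM k \<omega> * sgn (S k \<omega>) * X k \<omega>) = 0" if "k < n" for k
    unfolding S_def PM_def
  proof (rule orth[of k "\<lambda>u. partial_max u k * sgn (\<Sum>i<k. u i)", OF that])
    have "integrable M (\<lambda>\<omega>. PM k \<omega> * sgn (S k \<omega>))"
    proof (rule Bochner_Integration.integrable_bound)
      show "integrable M (PM k)" using PM_int that by simp
      show "(\<lambda>\<omega>. PM k \<omega> * sgn (S k \<omega>)) \<in> borel_measurable M"
        using that PM_meas[of k] borel_measurable_integrable[OF S_int[of k]] by auto
    qed (auto simp: abs_mult sgn_if)
    then show "integrable M (\<lambda>\<omega>. partial_max (\<lambda>i. X i \<omega>) k * sgn (\<Sum>i<k. X i \<omega>))"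
      by (simp add: S_def PM_def)
    show "partial_max u k * sgn (\<Sum>i<k. u i) = partial_max v k * sgn (\<Sum>i<k. v i)"
      if "\<And>i. i < k \<Longrightarrow> u i = v i" for u v :: "nat \<Rightarrow> real"
    proof -
      have "(\<Sum>i<k. u i) = (\<Sum>i<k. v i)" by (rule sum.cong) (use that in auto)
      then show ?thesis using partial_max_cong[OF that] by simp
    qed
    show "(\<lambda>u. partial_max u k * sgn (\<Sum>i<k. u i)) \<in> borel_measurable (PiM {..<k} (\<lambda>_. borel))"
      by (intro borel_measurable_times borel_measurable_sgn measurable_partial_max borel_measurable_sum) auto
  qed
  let ?R = "\<lambda>\<omega>. 4 * (S n \<omega>)\<^sup>2 - 4 * (\<Sum>k<n. PM k \<omega> * sgn (S k \<omega>) * X k \<omega>)"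
  have R: "integrable M ?R" using S_sq mart by (intro Bochner_Integration.integrable_diff integrable_mult_right Bochner_Integration.integrable_sum) auto
  have le: "(PM n \<omega>)\<^sup>2 \<le> ?R \<omega>" for \<omega>
    unfolding PM_def S_def by (rule pathwise_Doob_L2)
  have "integrable M (\<lambda>\<omega>. (PM n \<omega>)\<^sup>2)"
  proof (rule Bochner_Integration.integrable_bound[OF R])
    show "(\<lambda>\<omega>. (PM n \<omega>)\<^sup>2) \<in> borel_measurable M" using PM_meas[of n] by simp
    show "AE \<omega> in M. norm ((PM n \<omega>)\<^sup>2) \<le> norm (?R \<omega>)"
    proof (rule AE_I2)
      fix \<omega> show "norm ((PM n \<omega>)\<^sup>2) \<le> norm (?R \<omega>)"
        using le[of \<omega>] zero_le_power2[of "PM n \<omega>"] by simp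
    qed
  qed
  then show 1: "integrable M (\<lambda>\<omega>. (partial_max (\<lambda>i. X i \<omega>) n)\<^sup>2)" by (simp add: PM_def)
  have "expectation (\<lambda>\<omega>. (PM n \<omega>)\<^sup>2) \<le> expectation ?R"
    by (intro integral_mono R le) (use 1 PM_def in simp)
  also have "expectation ?R = 4 * expectation (\<lambda>\<omega>. (S n \<omega>)\<^sup>2)"
    using S_sq mart by (subst Bochner_Integration.integral_diff) auto
  finally show "expectation (\<lambda>\<omega>. (partial_max (\<lambda>i. X i \<omega>) n)\<^sup>2) \<le> 4 * (\<Sum>i<n. expectation (\<lambda>\<omega>. (X i \<omega>)\<^sup>2))"
    by (simp add: PM_def var)
qed

end

section \<open>Characteristic functions and rotated Gaussian noise\<close>

context prob_space
begin

lemma integrable_bounded_complex: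
  fixes f :: "'a \<Rightarrow> complex"
  assumes "f \<in> borel_measurable M" "\<And>\<omega>. norm (f \<omega>) \<le> B"
  shows "integrable M f"
  by (rule integrable_const_bound[where B = B]) (use assms in auto)

text \<open>The weight \<open>2 + Y\<close> is positive, so after normalisation it is a change of measure that leaves the
  characteristic function of \<open>X\<close> unchanged.\<close>
lemma weighted_char_unique_real:
  fixes X Y :: "'a \<Rightarrow> real" and c :: real
  assumes X[measurable]: "X \<in> borel_measurable M" and Y[measurable]: "Y \<in> borel_measurable M"
    and Yle: "\<And>\<omega>. \<bar>Y \<omega>\<bar> \<le> 1"
    and eq: "\<And>s. expectation (\<lambda>\<omega>. of_real (Y \<omega>) * iexp (s * X \<omega>)) = of_real c * expectation (\<lambda>\<omega>. iexp (s * X \<omega>))"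
    and A[measurable]: "A \<in> sets borel"
  shows "expectation (\<lambda>\<omega>. Y \<omega> * indicator A (X \<omega>)) = c * prob (X -` A \<inter> space M)"
proof -
  have Yint: "integrable M Y" by (rule integrable_const_bound[where B = 1]) (use Yle in auto)
  \<comment> \<open>Frequency 0 identifies \<open>c\<close> as the mean of \<open>Y\<close>. Hence
    \<open>c\<close> is at least -1, and \<open>2 + c\<close> is positive and the normalising
    constant of the weight \<open>2 + Y\<close>.\<close>
  have "complex_of_real (expectation Y) = of_real c"
    using eq[of 0] by (simp add: prob_space)
  then have c: "expectation Y = c" by (simp only: of_real_eq_iff)
  have "- 1 \<le> Y \<omega>" for \<omega> using Yle[of \<omega>] by linarith
  then have "- 1 \<le> c" unfolding c[symmetric]
    by (intro integral_ge_const Yint AE_I2) auto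
  define Z where "Z = (\<lambda>\<omega>. (2 + Y \<omega>) / (2 + c))"
  have Z0: "0 \<le> Z \<omega>" for \<omega> using Yle[of \<omega>] \<open>- 1 \<le> c\<close> by (simp add: Z_def)
  have Z[measurable]: "Z \<in> borel_measurable M" unfolding Z_def by measurable
  have Zint: "integrable M Z" unfolding Z_def using Yint by auto
  define Q where "Q = density M Z"
  have "expectation Z = 1" using Yint c \<open>- 1 \<le> c\<close> by (simp add: Z_def prob_space)
  then have "emeasure Q (space Q) = 1"
    by (simp add: Q_def emeasure_density nn_integral_eq_integral[OF Zint] Z0 cong: nn_integral_cong)
  then interpret Q: prob_space Q by (rule prob_spaceI)
  have XQ[measurable]: "X \<in> borel_measurable Q" by (simp add: Q_def)
  have "distr Q borel X = distr M borel X"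
  proof (rule Levy_uniqueness)
    show "real_distribution (distr Q borel X)" by (rule Q.real_distribution_distr) (rule XQ)
    show "real_distribution (distr M borel X)" by simp
    show "char (distr Q borel X) = char (distr M borel X)"
    proof
      fix s
      have i1: "integrable M (\<lambda>\<omega>. iexp (s * X \<omega>))"
        by (rule integrable_bounded_complex[where B = 1]) auto
      have i2: "integrable M (\<lambda>\<omega>. of_real (Y \<omega>) * iexp (s * X \<omega>))"
        by (rule integrable_bounded_complex[where B = 1]) (use Yle in \<open>auto simp: norm_mult\<close>)
      have "char (distr Q borel X) s = (CLINT \<omega>|Q. iexp (s * X \<omega>))"
        unfolding char_def by (rule integral_distr) auto
      also have "\<dots> = expectation (\<lambda>\<omega>. Z \<omega> *\<^sub>R iexp (s * X \<omega>))"
        unfolding Q_def by (rule integral_density) (use Z0 in auto)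
      also have "\<dots> = expectation (\<lambda>\<omega>. (2 * iexp (s * X \<omega>) + of_real (Y \<omega>) * iexp (s * X \<omega>)) / of_real (2 + c))"
        by (intro Bochner_Integration.integral_cong refl) (simp add: Z_def scaleR_conv_of_real add_divide_distrib algebra_simps)
      also have "\<dots> = expectation (\<lambda>\<omega>. (2 * iexp (s * X \<omega>) + of_real (Y \<omega>) * iexp (s * X \<omega>))) / of_real (2 + c)"
        by simp
      also have "expectation (\<lambda>\<omega>. (2 * iexp (s * X \<omega>) + of_real (Y \<omega>) * iexp (s * X \<omega>)))
          = of_real (2 + c) * expectation (\<lambda>\<omega>. iexp (s * X \<omega>))"
        using i1 i2 by (subst Bochner_Integration.integral_add) (auto simp: eq[simplified] algebra_simps)
      also have "\<dots> / of_real (2 + c) = expectation (\<lambda>\<omega>. iexp (s * X \<omega>))"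
        using \<open>- 1 \<le> c\<close> by (subst nonzero_mult_div_cancel_left) (auto simp del: of_real_add)
      also have "\<dots> = char (distr M borel X) s"
        unfolding char_def by (rule integral_distr[symmetric]) auto
      finally show "char (distr Q borel X) s = char (distr M borel X) s" .
    qed
  qed
  \<comment> \<open>Equal laws give \<open>X\<close> the same probability of lying in
    \<open>A\<close> under both measures; written out under \<open>Q\<close>, this equation is
    solved for the term containing \<open>Y\<close>.\<close>
  then have "measure (distr Q borel X) A = measure (distr M borel X) A" by simp
  then have "measure Q (X -` A \<inter> space M) = prob (X -` A \<inter> space M)"
    by (subst (asm) (1 2) measure_distr) (auto simp: Q_def)
  moreover have "measure Q (X -` A \<inter> space M) = expectation (\<lambda>\<omega>. Z \<omega> * indicator (X -` A \<inter> space M) \<omega>)"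
  proof -
    have "measure Q (X -` A \<inter> space M) = (LINT \<omega>|Q. indicator (X -` A \<inter> space M) \<omega>)"
      by (simp add: Q_def)
    also have "\<dots> = expectation (\<lambda>\<omega>. Z \<omega> *\<^sub>R indicator (X -` A \<inter> space M) \<omega>)"
      unfolding Q_def by (rule integral_density) (use Z0 in auto)
    finally show ?thesis by simp
  qed
  moreover have "expectation (\<lambda>\<omega>. Z \<omega> * indicator (X -` A \<inter> space M) \<omega>)
      = expectation (\<lambda>\<omega>. (2 * indicator (X -` A \<inter> space M) \<omega> + Y \<omega> * indicator A (X \<omega>)) / (2 + c))"
    by (intro Bochner_Integration.integral_cong refl) (auto simp: Z_def indicator_def field_simps)
  moreover have "\<dots> = (2 * prob (X -` A \<inter> space M) + expectation (\<lambda>\<omega>. Y \<omega> * indicator A (X \<omega>))) / (2 + c)"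
  proof -
    have "integrable M (\<lambda>\<omega>. Y \<omega> * indicator A (X \<omega>))"
      by (rule integrable_const_bound[where B = 1]) (use Yle in \<open>auto simp: indicator_def\<close>)
    then show ?thesis by (simp add: emeasure_eq_measure)
  qed
  ultimately show ?thesis using \<open>- 1 \<le> c\<close> by (simp add: field_simps)
qed

text \<open>Conjugating the hypothesis at frequency \<open>- s\<close> yields the same hypothesis
  for \<open>cnj Y\<close> and \<open>cnj c\<close>. Linear combinations then give it for the real
  and imaginary parts, to which the real case applies.\<close>

lemma weighted_char_unique:
  fixes X :: "'a \<Rightarrow> real" and Y :: "'a \<Rightarrow> complex" and c :: complex
  assumes X[measurable]: "X \<in> borel_measurable M" and Y[measurable]: "Y \<in> borel_measurable M"
    and Yle: "\<And>\<omega>. norm (Y \<omega>) \<le> 1"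
    and eq: "\<And>s. expectation (\<lambda>\<omega>. Y \<omega> * iexp (s * X \<omega>)) = c * expectation (\<lambda>\<omega>. iexp (s * X \<omega>))"
    and A[measurable]: "A \<in> sets borel"
  shows "expectation (\<lambda>\<omega>. Y \<omega> * indicator A (X \<omega>)) = c * of_real (prob (X -` A \<inter> space M))"
proof -
  have [measurable]: "(\<lambda>\<omega>. cnj (Y \<omega>)) \<in> borel_measurable M"
    by (rule measurable_compose[OF Y borel_measurable_continuous_onI]) (intro continuous_intros)
  have i: "integrable M (\<lambda>\<omega>. Y \<omega> * iexp (s * X \<omega>))" "integrable M (\<lambda>\<omega>. cnj (Y \<omega>) * iexp (s * X \<omega>))" for s
    by (rule integrable_bounded_complex[where B = 1]; use Yle in \<open>auto simp: norm_mult\<close>)+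
  have eq': "expectation (\<lambda>\<omega>. cnj (Y \<omega>) * iexp (s * X \<omega>)) = cnj c * expectation (\<lambda>\<omega>. iexp (s * X \<omega>))" for s
  proof -
    have *: "iexp (s * x) = cnj (iexp (- s * x))" for x :: real by (simp add: exp_cnj)
    have "expectation (\<lambda>\<omega>. cnj (Y \<omega>) * iexp (s * X \<omega>)) = expectation (\<lambda>\<omega>. cnj (Y \<omega> * iexp (- s * X \<omega>)))"
      by (subst *) simp
    also have "\<dots> = cnj (c * expectation (\<lambda>\<omega>. iexp (- s * X \<omega>)))"
      by (subst Bochner_Integration.integral_cnj) (simp only: eq)
    also have "\<dots> = cnj c * expectation (\<lambda>\<omega>. cnj (iexp (- s * X \<omega>)))"
      by (simp only: Bochner_Integration.integral_cnj complex_cnj_mult)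
    finally show ?thesis by (subst *)
  qed
  have re: "expectation (\<lambda>\<omega>. of_real (Re (Y \<omega>)) * iexp (s * X \<omega>)) = of_real (Re c) * expectation (\<lambda>\<omega>. iexp (s * X \<omega>))" for s
  proof -
    have r: "complex_of_real (Re z) = (z + cnj z) / 2" for z by (simp add: complex_eq_iff)
    have "expectation (\<lambda>\<omega>. of_real (Re (Y \<omega>)) * iexp (s * X \<omega>))
      = expectation (\<lambda>\<omega>. (Y \<omega> * iexp (s * X \<omega>) + cnj (Y \<omega>) * iexp (s * X \<omega>)) / 2)"
      by (simp add: r algebra_simps add_divide_distrib)
    also have "\<dots> = (c * expectation (\<lambda>\<omega>. iexp (s * X \<omega>)) + cnj c * expectation (\<lambda>\<omega>. iexp (s * X \<omega>))) / 2"
      by (subst integral_divide_zero, subst Bochner_Integration.integral_add[OF i]) (simp only: eq eq')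
    finally show ?thesis unfolding r by (simp add: algebra_simps)
  qed
  have im: "expectation (\<lambda>\<omega>. of_real (Im (Y \<omega>)) * iexp (s * X \<omega>)) = of_real (Im c) * expectation (\<lambda>\<omega>. iexp (s * X \<omega>))" for s
  proof -
    have r: "complex_of_real (Im z) = (- \<i> / 2) * (z - cnj z)" for z by (simp add: complex_eq_iff)
    have "expectation (\<lambda>\<omega>. of_real (Im (Y \<omega>)) * iexp (s * X \<omega>))
      = expectation (\<lambda>\<omega>. (- \<i> / 2) * (Y \<omega> * iexp (s * X \<omega>) - cnj (Y \<omega>) * iexp (s * X \<omega>)))"
      by (simp only: r mult.assoc left_diff_distrib)
    also have "\<dots> = (- \<i> / 2) * (c * expectation (\<lambda>\<omega>. iexp (s * X \<omega>)) - cnj c * expectation (\<lambda>\<omega>. iexp (s * X \<omega>)))"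
      by (subst integral_mult_right_zero, subst Bochner_Integration.integral_diff[OF i]) (simp only: eq eq')
    finally show ?thesis by (simp only: r mult.assoc left_diff_distrib)
  qed
  have "expectation (\<lambda>\<omega>. Re (Y \<omega>) * indicator A (X \<omega>)) = Re c * prob (X -` A \<inter> space M)"
    by (rule weighted_char_unique_real[OF X _ _ re A]) (use Yle in \<open>auto intro: order_trans[OF abs_Re_le_cmod]\<close>)
  moreover have "expectation (\<lambda>\<omega>. Im (Y \<omega>) * indicator A (X \<omega>)) = Im c * prob (X -` A \<inter> space M)"
    by (rule weighted_char_unique_real[OF X _ _ im A]) (use Yle in \<open>auto intro: order_trans[OF abs_Im_le_cmod]\<close>)
  moreover have iA: "integrable M (\<lambda>\<omega>. Y \<omega> * indicator A (X \<omega>))"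
    by (rule integrable_bounded_complex[where B = 1]) (use Yle in \<open>auto simp: indicator_def\<close>)
  moreover have "Re (Y \<omega> * indicator A (X \<omega>)) = Re (Y \<omega>) * indicator A (X \<omega>)"
     "Im (Y \<omega> * indicator A (X \<omega>)) = Im (Y \<omega>) * indicator A (X \<omega>)" for \<omega>
    by (auto simp: indicator_def)
  ultimately show ?thesis
    by (simp add: complex_eq_iff flip: integral_Re integral_Im)
qed

section \<open>Independence from the factorisation of the joint characteristic function\<close>

lemma indep_vars_if_char_factorizes:
  fixes X :: "nat \<Rightarrow> 'a \<Rightarrow> real"
  assumes X: "\<And>i. i < n \<Longrightarrow> X i \<in> borel_measurable M"
    and fac: "\<And>t. expectation (\<lambda>\<omega>. iexp (\<Sum>i<n. t i * X i \<omega>)) = (\<Prod>i<n. expectation (\<lambda>\<omega>. iexp (t i * X i \<omega>)))"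
  shows "indep_vars (\<lambda>_. borel) X {..<n}"
proof (cases "n = 0")
  case True
  then show ?thesis by (simp add: indep_vars_def indep_sets_def)
next
  \<comment> \<open>A nonempty index set matters: the intersection over no indices would be the
    whole type instead of the sample space.\<close>
  case False
  define \<phi> where "\<phi> = (\<lambda>i s. expectation (\<lambda>\<omega>. iexp (s * X i \<omega>)))"
  \<comment> \<open>The factors \<open>iexp (t i * X i)\<close> are turned into indicators one at a time.\<close>
  have key: "expectation (\<lambda>\<omega>. (\<Prod>i<k. indicator (A i) (X i \<omega>)) * iexp (\<Sum>i=k..<n. t i * X i \<omega>))
      = (\<Prod>i<k. of_real (prob (X i -` A i \<inter> space M))) * (\<Prod>i=k..<n. \<phi> i (t i))"
    if "k \<le> n" and A: "\<And>i. i < n \<Longrightarrow> A i \<in> sets borel" for k A t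
    using that(1)
  proof (induction k arbitrary: t)
    case 0
    show ?case using fac[of t] by (simp add: \<phi>_def lessThan_atLeast0)
  next
    case (Suc k)
    then have k: "k < n" by simp
    \<comment> \<open>All factors except that of \<open>X k\<close>: the indicators already obtained
      and the exponentials still to be converted. Their product has modulus at most 1, so it is an
      admissible weight.\<close>
    define Y where "Y = (\<lambda>\<omega>. (\<Prod>i<k. indicator (A i) (X i \<omega>)) * iexp (\<Sum>i=Suc k..<n. t i * X i \<omega>))"
    define c where "c = (\<Prod>i<k. complex_of_real (prob (X i -` A i \<inter> space M))) * (\<Prod>i=Suc k..<n. \<phi> i (t i))"
    have "expectation (\<lambda>\<omega>. Y \<omega> * indicator (A k) (X k \<omega>)) = c * of_real (prob (X k -` A k \<inter> space M))"
    proof (rule weighted_char_unique)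
      show "X k \<in> borel_measurable M" "A k \<in> sets borel" using X A k by auto
      have "(\<lambda>\<omega>. indicator (A i) (X i \<omega>) :: complex) \<in> borel_measurable M" if "i < n" for i
        using measurable_compose[OF X[OF that] borel_measurable_indicator[OF A[OF that]]] .
      moreover have "(\<lambda>\<omega>. iexp (\<Sum>i=Suc k..<n. t i * X i \<omega>)) \<in> borel_measurable M"
        by (intro borel_measurable_exp[THEN measurable_compose[rotated]] borel_measurable_times
            borel_measurable_const borel_measurable_of_real[THEN measurable_compose[rotated]] borel_measurable_sum X) auto
      ultimately show "Y \<in> borel_measurable M"
        unfolding Y_def using k by (intro borel_measurable_times borel_measurable_prod) auto
      show "norm (Y \<omega>) \<le> 1" for \<omega>
        unfolding Y_def norm_mult norm_exp_i_times mult_1_right prod_norm[symmetric]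
        by (intro prod_le_1) (auto simp: indicator_def)
      \<comment> \<open>The induction hypothesis is used at \<open>t(k := s)\<close>: the frequency
        of \<open>X k\<close> runs freely while the others stay fixed. This is why the induction is
        over arbitrary \<open>t\<close>.\<close>
      show "expectation (\<lambda>\<omega>. Y \<omega> * iexp (s * X k \<omega>)) = c * expectation (\<lambda>\<omega>. iexp (s * X k \<omega>))" for s
      proof -
        have "expectation (\<lambda>\<omega>. Y \<omega> * iexp (s * X k \<omega>))
          = expectation (\<lambda>\<omega>. (\<Prod>i<k. indicator (A i) (X i \<omega>)) * iexp (\<Sum>i=k..<n. (t(k := s)) i * X i \<omega>))"
        proof (intro Bochner_Integration.integral_cong refl)
          fix \<omega>
          have "(\<Sum>i=Suc k..<n. (t(k := s)) i * X i \<omega>) = (\<Sum>i=Suc k..<n. t i * X i \<omega>)"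
            by (intro sum.cong) auto
          then have "(\<Sum>i=k..<n. (t(k := s)) i * X i \<omega>) = s * X k \<omega> + (\<Sum>i=Suc k..<n. t i * X i \<omega>)"
            using k by (simp add: sum.atLeast_Suc_lessThan)
          then show "Y \<omega> * iexp (s * X k \<omega>)
            = (\<Prod>i<k. indicator (A i) (X i \<omega>)) * iexp (\<Sum>i=k..<n. (t(k := s)) i * X i \<omega>)"
            by (simp add: Y_def ring_distribs exp_add)
        qed
        also have "\<dots> = (\<Prod>i<k. of_real (prob (X i -` A i \<inter> space M))) * (\<Prod>i=k..<n. \<phi> i ((t(k := s)) i))"
          using Suc by simp
        also have "(\<Prod>i=k..<n. \<phi> i ((t(k := s)) i)) = \<phi> k s * (\<Prod>i=Suc k..<n. \<phi> i (t i))"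
          using k by (simp add: prod.atLeast_Suc_lessThan cong: prod.cong_simp)
        finally show ?thesis by (simp add: c_def \<phi>_def)
      qed
    qed
    then show ?case by (simp add: Y_def c_def mult_ac)
  qed
  show ?thesis
  proof (subst indep_vars_finite[where E = "\<lambda>_. sets borel"])
    show "\<forall>A\<in>{..<n} \<rightarrow> sets borel. prob (\<Inter>j\<in>{..<n}. X j -` A j \<inter> space M)
        = (\<Prod>j<n. prob (X j -` A j \<inter> space M))"
    proof
      fix A :: "nat \<Rightarrow> real set"
      assume "A \<in> {..<n} \<rightarrow> sets borel"
      then have A: "\<And>i. i < n \<Longrightarrow> A i \<in> sets borel" by auto
      let ?I = "\<Inter>j\<in>{..<n}. X j -` A j \<inter> space M"
      have "?I \<in> events"
        using \<open>n \<noteq> 0\<close> by (intro sets.finite_INT measurable_sets[OF X A]) auto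
      have "expectation (\<lambda>\<omega>. (\<Prod>i<n. indicator (A i) (X i \<omega>)) :: complex) = expectation (\<lambda>\<omega>. of_real (indicator ?I \<omega>))"
        using \<open>n \<noteq> 0\<close> by (intro Bochner_Integration.integral_cong refl) (auto simp: indicator_def prod_eq_1_iff)
      also have "\<dots> = of_real (prob ?I)"
        using \<open>?I \<in> events\<close> by simp
      finally show "prob ?I = (\<Prod>j<n. prob (X j -` A j \<inter> space M))"
        using key[OF order_refl A] by (simp flip: of_real_prod)
    qed
  qed (use False X in \<open>auto simp: Int_stable_def sets.sigma_sets_eq[of borel, simplified]\<close>)
qed

section \<open>Rotation invariance of white Gaussian noise\<close>

lemma normal_iexp_expectation:
  assumes X: "distributed M lborel X (\<lambda>t. ennreal (normal_density 0 \<sigma> t))" and "\<sigma> > 0"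
  shows "expectation (\<lambda>\<omega>. iexp (s * X \<omega>)) = of_real (exp (- ((\<sigma> * s)\<^sup>2 / 2)))"
proof -
  have [measurable]: "X \<in> borel_measurable M" using X by (simp add: distributed_def)
  have "distributed M lborel (\<lambda>\<omega>. (X \<omega> - 0) / \<sigma>) std_normal_density"
    using X normal_standard_normal_convert[OF \<open>\<sigma> > 0\<close>] by blast
  then have "distr M lborel (\<lambda>\<omega>. X \<omega> / \<sigma>) = std_normal_distribution"
    by (simp add: distributed_def)
  then have "distr M borel (\<lambda>\<omega>. X \<omega> / \<sigma>) = std_normal_distribution"
    by (simp cong: distr_cong)
  then have "of_real (exp (- ((\<sigma> * s)\<^sup>2 / 2))) = char (distr M borel (\<lambda>\<omega>. X \<omega> / \<sigma>)) (\<sigma> * s)"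
    by (simp add: char_std_normal_distribution)
  also have "\<dots> = expectation (\<lambda>\<omega>. iexp (\<sigma> * s * (X \<omega> / \<sigma>)))"
    unfolding char_def by (rule integral_distr) auto
  finally show ?thesis using \<open>\<sigma> > 0\<close> by simp
qed

lemma normal_sum_iexp_expectation:
  fixes e :: "nat \<Rightarrow> 'a \<Rightarrow> real"
  assumes ind: "indep_vars (\<lambda>_. borel) e {..<n}"
    and e: "\<And>i. i < n \<Longrightarrow> distributed M lborel (e i) (\<lambda>t. ennreal (normal_density 0 \<sigma> t))"
    and "\<sigma> > 0"
  shows "expectation (\<lambda>\<omega>. iexp (\<Sum>j<n. c j * e j \<omega>)) = of_real (exp (- (\<sigma>\<^sup>2 * (\<Sum>j<n. (c j)\<^sup>2) / 2)))"
proof -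
  have m: "e i \<in> borel_measurable M" if "i < n" for i
    using e[OF that] by (simp add: distributed_def)
  have i': "indep_vars (\<lambda>_. borel) (\<lambda>j \<omega>. c j * e j \<omega>) {..<n}"
    by (rule indep_vars_compose2[OF ind]) auto
  have "expectation (\<lambda>\<omega>. iexp (\<Sum>j<n. c j * e j \<omega>)) = char (distr M borel (\<lambda>\<omega>. \<Sum>j<n. c j * e j \<omega>)) 1"
    unfolding char_def using m by (subst integral_distr) auto
  also have "\<dots> = (\<Prod>j<n. char (distr M borel (\<lambda>\<omega>. c j * e j \<omega>)) 1)"
    by (rule char_distr_sum[OF i'])
  also have "\<dots> = (\<Prod>j<n. of_real (exp (- ((\<sigma> * c j)\<^sup>2 / 2))))"
  proof (intro prod.cong refl)
    fix j assume "j \<in> {..<n}"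
    then have "char (distr M borel (\<lambda>\<omega>. c j * e j \<omega>)) 1 = expectation (\<lambda>\<omega>. iexp (c j * e j \<omega>))"
      unfolding char_def using m[of j] by (subst integral_distr) auto
    then show "char (distr M borel (\<lambda>\<omega>. c j * e j \<omega>)) 1 = of_real (exp (- ((\<sigma> * c j)\<^sup>2 / 2)))"
      using normal_iexp_expectation[OF e \<open>\<sigma> > 0\<close>, of j "c j"] \<open>j \<in> {..<n}\<close> by simp
  qed
  also have "\<dots> = of_real (exp (- (\<sigma>\<^sup>2 * (\<Sum>j<n. (c j)\<^sup>2) / 2)))"
    by (simp only: of_real_prod[symmetric] exp_sum[symmetric] finite_lessThan)
       (simp add: sum_negf sum_distrib_left sum_divide_distrib power_mult_distrib)
  finally show ?thesis .
qed

text \<open>With orthonormal rows, the transposed rotation preserves the Euclidean norm of the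
  frequency vector, and the joint characteristic function of white noise depends on that norm only.
  It is thus again a product of one-dimensional Gaussian factors; frequency vectors supported on one
  coordinate give the marginals.\<close>

lemma normal_rotation:
  fixes e :: "nat \<Rightarrow> 'a \<Rightarrow> real" and a :: "nat \<Rightarrow> nat \<Rightarrow> real"
  assumes ind: "indep_vars (\<lambda>_. borel) e {..<n}"
    and e: "\<And>i. i < n \<Longrightarrow> distributed M lborel (e i) (\<lambda>t. ennreal (normal_density 0 \<sigma> t))"
    and "\<sigma> > 0"
    and orth: "\<And>i k. i < n \<Longrightarrow> k < n \<Longrightarrow> (\<Sum>j<n. a i j * a k j) = (if i = k then 1 else 0)"
  defines "e' \<equiv> \<lambda>i \<omega>. \<Sum>j<n. a i j * e j \<omega>"
  shows "indep_vars (\<lambda>_. borel) e' {..<n}"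
    and "\<And>i. i < n \<Longrightarrow> distributed M lborel (e' i) (\<lambda>t. ennreal (normal_density 0 \<sigma> t))"
proof -
  have m: "e i \<in> borel_measurable M" if "i < n" for i
    using e[OF that] by (simp add: distributed_def)
  have m': "e' i \<in> borel_measurable M" for i
    unfolding e'_def using m by (intro borel_measurable_sum borel_measurable_times) auto
  have joint: "expectation (\<lambda>\<omega>. iexp (\<Sum>i<n. t i * e' i \<omega>)) = of_real (exp (- (\<sigma>\<^sup>2 * (\<Sum>i<n. (t i)\<^sup>2) / 2)))" for t
  proof -
    define c where "c = (\<lambda>j. \<Sum>i<n. t i * a i j)"
    have "(\<Sum>i<n. t i * e' i \<omega>) = (\<Sum>j<n. c j * e j \<omega>)" for \<omega>
      unfolding e'_def c_def sum_distrib_left sum_distrib_right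
      by (subst sum.swap) (simp add: mult.assoc)
    moreover have "(\<Sum>j<n. (c j)\<^sup>2) = (\<Sum>i<n. (t i)\<^sup>2)"
    proof -
      have "(\<Sum>j<n. (c j)\<^sup>2) = (\<Sum>j<n. \<Sum>i<n. \<Sum>k<n. t i * t k * (a i j * a k j))"
        by (simp add: c_def power2_eq_square sum_product mult_ac)
      also have "\<dots> = (\<Sum>i<n. \<Sum>j<n. \<Sum>k<n. t i * t k * (a i j * a k j))"
        by (rule sum.swap)
      \<comment> \<open>With the sum over \<open>j\<close> innermost, the Gram matrix of the rows
        appears, which is the identity.\<close>
      also have "\<dots> = (\<Sum>i<n. \<Sum>k<n. t i * t k * (\<Sum>j<n. a i j * a k j))"
        unfolding sum_distrib_left by (intro sum.cong refl sum.swap)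
      also have "\<dots> = (\<Sum>i<n. \<Sum>k<n. if k = i then (t i)\<^sup>2 else 0)"
        by (intro sum.cong refl) (simp add: orth power2_eq_square)
      finally show ?thesis by simp
    qed
    ultimately show ?thesis using normal_sum_iexp_expectation[OF ind e \<open>\<sigma> > 0\<close>, of c] by simp
  qed
  have single: "expectation (\<lambda>\<omega>. iexp (s * e' i \<omega>)) = of_real (exp (- ((\<sigma> * s)\<^sup>2 / 2)))" if "i < n" for i s
  proof -
    have "(\<Sum>k<n. (if k = i then s else 0) * e' k \<omega>) = s * e' i \<omega>" for \<omega>
      using that by (simp add: if_distrib[of "\<lambda>x. x * _"] cong: if_cong)
    moreover have "(\<Sum>k<n. (if k = i then s else 0)\<^sup>2) = s\<^sup>2"
      using that by (simp add: if_distrib[of "\<lambda>x. x\<^sup>2"] cong: if_cong)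
    ultimately show ?thesis using joint[of "\<lambda>k. if k = i then s else 0"]
      by (simp add: power_mult_distrib)
  qed
  show "indep_vars (\<lambda>_. borel) e' {..<n}"
  proof (rule indep_vars_if_char_factorizes[OF m'])
    fix t
    have "(\<Prod>i<n. expectation (\<lambda>\<omega>. iexp (t i * e' i \<omega>))) = (\<Prod>i<n. of_real (exp (- ((\<sigma> * t i)\<^sup>2 / 2))))"
      by (intro prod.cong refl single) simp
    also have "\<dots> = of_real (exp (- (\<sigma>\<^sup>2 * (\<Sum>i<n. (t i)\<^sup>2) / 2)))"
      by (simp only: of_real_prod[symmetric] exp_sum[symmetric] finite_lessThan)
         (simp add: sum_negf sum_distrib_left sum_divide_distrib power_mult_distrib)
    finally show "expectation (\<lambda>\<omega>. iexp (\<Sum>i<n. t i * e' i \<omega>)) = (\<Prod>i<n. expectation (\<lambda>\<omega>. iexp (t i * e' i \<omega>)))"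
      using joint by simp
  qed
  fix i assume i: "i < n"
  have char: "char (distr M borel X) s = expectation (\<lambda>\<omega>. iexp (s * X \<omega>))" if "X \<in> borel_measurable M" for X s
    unfolding char_def using that by (subst integral_distr) auto
  \<comment> \<open>Both variables have the same Gaussian characteristic function, so the density of
    \<open>e' i\<close> can be taken over from \<open>e i\<close>.\<close>
  have "distr M borel (e' i) = distr M borel (e i)"
    by (rule Levy_uniqueness)
      (use i m' m in \<open>auto simp only: char single normal_iexp_expectation[OF e \<open>\<sigma> > 0\<close>] intro!: real_distribution_distr ext\<close>)
  then have "distr M lborel (e' i) = distr M lborel (e i)"
    by (simp cong: distr_cong)
  then show "distributed M lborel (e' i) (\<lambda>t. ennreal (normal_density 0 \<sigma> t))"
    using e[OF i] m' by (simp add: distributed_def)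
qed

section \<open>Gaussian moments up to order four\<close>

lemma normal_moments:
  assumes X: "distributed M lborel X (\<lambda>t. ennreal (normal_density 0 \<sigma> t))" and "\<sigma> > 0"
  shows "integrable M (\<lambda>\<omega>. X \<omega> ^ k)"
    and "expectation (\<lambda>\<omega>. X \<omega> ^ (2 * k)) = fact (2 * k) / ((2 / \<sigma>\<^sup>2) ^ k * fact k)"
    and "expectation (\<lambda>\<omega>. X \<omega> ^ (2 * k + 1)) = 0"
proof -
  have eq: "expectation (\<lambda>\<omega>. X \<omega> ^ k) = (LINT t|lborel. normal_density 0 \<sigma> t * t ^ k)" for k
    by (rule distributed_integral[OF X, symmetric]) (auto simp: normal_density_nonneg)
  show "integrable M (\<lambda>\<omega>. X \<omega> ^ k)"
    using integrable_normal_moment[OF \<open>\<sigma> > 0\<close>, of 0 k]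
    by (subst distributed_integrable[OF X, symmetric]) (auto simp: normal_density_nonneg)
  show "expectation (\<lambda>\<omega>. X \<omega> ^ (2 * k)) = fact (2 * k) / ((2 / \<sigma>\<^sup>2) ^ k * fact k)"
    using integral_normal_moment_even[OF \<open>\<sigma> > 0\<close>, of 0 k] by (simp only: eq diff_zero)
  show "expectation (\<lambda>\<omega>. X \<omega> ^ (2 * k + 1)) = 0"
    using integral_normal_moment_odd[OF \<open>\<sigma> > 0\<close>, of 0 k] by (simp only: eq diff_zero)
qed

text \<open>The mixed term contains only odd moments and vanishes. The purely quadratic part
  contributes \<open>3 * \<sigma> ^ 4 - 2 * \<sigma> ^ 4 + \<sigma> ^ 4\<close>, which is the source
  of the factor 2.\<close>

lemma normal_quadratic_moments:
  assumes X: "distributed M lborel X (\<lambda>t. ennreal (normal_density 0 \<sigma> t))" and "\<sigma> > 0"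
  shows "expectation (\<lambda>\<omega>. a * X \<omega> + b * ((X \<omega>)\<^sup>2 - \<sigma>\<^sup>2)) = 0"
    and "integrable M (\<lambda>\<omega>. (a * X \<omega> + b * ((X \<omega>)\<^sup>2 - \<sigma>\<^sup>2))\<^sup>2)"
    and "expectation (\<lambda>\<omega>. (a * X \<omega> + b * ((X \<omega>)\<^sup>2 - \<sigma>\<^sup>2))\<^sup>2) = a\<^sup>2 * \<sigma>\<^sup>2 + 2 * b\<^sup>2 * \<sigma> ^ 4"
proof -
  note I = normal_moments(1)[OF X \<open>\<sigma> > 0\<close>]
  have I1: "integrable M X" using I[of 1] by simp
  have E1: "expectation X = 0" using normal_moments(3)[OF X \<open>\<sigma> > 0\<close>, of 0] by simp
  have E2: "expectation (\<lambda>\<omega>. X \<omega> ^ 2) = \<sigma>\<^sup>2"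
    using normal_moments(2)[OF X \<open>\<sigma> > 0\<close>, of 1] by (simp add: power2_eq_square)
  have E3: "expectation (\<lambda>\<omega>. X \<omega> ^ 3) = 0" using normal_moments(3)[OF X \<open>\<sigma> > 0\<close>, of 1] by simp
  have E4: "expectation (\<lambda>\<omega>. X \<omega> ^ 4) = 3 * \<sigma> ^ 4"
    using normal_moments(2)[OF X \<open>\<sigma> > 0\<close>, of 2] \<open>\<sigma> > 0\<close>
    by (simp add: fact_numeral power_divide)
  show "expectation (\<lambda>\<omega>. a * X \<omega> + b * ((X \<omega>)\<^sup>2 - \<sigma>\<^sup>2)) = 0"
    using I1 I[of 2] E1 E2 by (simp add: prob_space)
  have eq: "(\<lambda>\<omega>. (a * X \<omega> + b * ((X \<omega>)\<^sup>2 - \<sigma>\<^sup>2))\<^sup>2)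
    = (\<lambda>\<omega>. b\<^sup>2 * X \<omega> ^ 4 + 2 * a * b * X \<omega> ^ 3 + (a\<^sup>2 - 2 * b\<^sup>2 * \<sigma>\<^sup>2) * X \<omega> ^ 2 + (- 2 * a * b * \<sigma>\<^sup>2) * X \<omega> + b\<^sup>2 * \<sigma> ^ 4)"
    by (simp add: fun_eq_iff power2_eq_square power3_eq_cube power4_eq_xxxx algebra_simps)
  show "integrable M (\<lambda>\<omega>. (a * X \<omega> + b * ((X \<omega>)\<^sup>2 - \<sigma>\<^sup>2))\<^sup>2)"
    unfolding eq using I1 I by simp
  show "expectation (\<lambda>\<omega>. (a * X \<omega> + b * ((X \<omega>)\<^sup>2 - \<sigma>\<^sup>2))\<^sup>2) = a\<^sup>2 * \<sigma>\<^sup>2 + 2 * b\<^sup>2 * \<sigma> ^ 4"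
    unfolding eq using I1 I E1 E2 E3 E4
    by (simp add: prob_space) (simp add: power2_eq_square power4_eq_xxxx algebra_simps)
qed

end

section \<open>Tikhonov regularisation in singular coordinates\<close>

lemma svd_product_index:
  assumes "U \<in> carrier_mat n n" "V \<in> carrier_mat n n" "i < n" "j < n"
  shows "(U * mat_diag n f * transpose_mat V) $$ (i, j) = (\<Sum>k<n. U $$ (i, k) * f k * V $$ (j, k))"
  using assms by (subst mat_diag_mult_right[of _ n]) (auto simp: scalar_prod_def lessThan_atLeast0)

lemma svd_product_carrier:
  "U \<in> carrier_mat n n \<Longrightarrow> V \<in> carrier_mat n n \<Longrightarrow> U * mat_diag n f * transpose_mat V \<in> carrier_mat n n"
  by auto

lemma svd_product_transpose:
  assumes "U \<in> carrier_mat n n" "V \<in> carrier_mat n n"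
  shows "transpose_mat (U * mat_diag n f * transpose_mat V) = V * mat_diag n f * transpose_mat (U :: real mat)"
  using assms by (intro eq_matI) (auto simp: svd_product_index[of _ n] mult_ac simp del: index_mult_mat(1))

text \<open>The adjacent orthogonal factors cancel. Together with the rules for transposes and sums,
  this reduces the matrix identities below to pointwise identities between diagonals.\<close>

lemma svd_product_mult:
  fixes U V W :: "real mat"
  assumes U: "U \<in> carrier_mat n n" and V: "is_orthogonal_matrix n V" and W: "W \<in> carrier_mat n n"
  shows "(U * mat_diag n f * transpose_mat V) * (V * mat_diag n g * transpose_mat W)
    = U * mat_diag n (\<lambda>i. f i * g i) * transpose_mat W"
proof -
  have Vc: "V \<in> carrier_mat n n" "transpose_mat V * V = 1\<^sub>m n" using V by (auto simp: is_orthogonal_matrix_def)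
  have T: "transpose_mat V \<in> carrier_mat n n" "transpose_mat W \<in> carrier_mat n n" using Vc W by auto
  have D: "mat_diag n f \<in> carrier_mat n n" "mat_diag n g \<in> carrier_mat n n" by auto
  have "(U * mat_diag n f * transpose_mat V) * (V * mat_diag n g * transpose_mat W)
      = U * mat_diag n f * ((transpose_mat V * V) * mat_diag n g * transpose_mat W)"
    using U Vc(1) T D by (simp add: assoc_mult_mat[of _ n n _ n _ n] mult_carrier_mat[of _ n n _ n])
  also have "\<dots> = U * (mat_diag n f * mat_diag n g) * transpose_mat W"
    using U T D by (simp add: Vc(2) assoc_mult_mat[of _ n n _ n _ n] mult_carrier_mat[of _ n n _ n] left_mult_one_mat[of _ n n] del: mat_diag_diag)
  finally show ?thesis by simp
qed

lemma svd_product_add: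
  fixes V :: "real mat"
  assumes "V \<in> carrier_mat n n"
  shows "V * mat_diag n f * transpose_mat V + V * mat_diag n g * transpose_mat V
    = V * mat_diag n (\<lambda>i. f i + g i) * transpose_mat V"
  using assms by (intro eq_matI)
   (auto simp: svd_product_index[of _ n] algebra_simps sum.distrib simp del: index_mult_mat(1))

lemma svd_product_const:
  assumes V: "is_orthogonal_matrix n V"
  shows "V * mat_diag n (\<lambda>_. c) * transpose_mat V = c \<cdot>\<^sub>m 1\<^sub>m n"
proof -
  have Vc: "V \<in> carrier_mat n n" "V * transpose_mat V = 1\<^sub>m n" using V by (auto simp: is_orthogonal_matrix_def)
  have "mat_diag n (\<lambda>_. c) = c \<cdot>\<^sub>m 1\<^sub>m n" by (rule eq_matI) (auto simp: mat_diag_def)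
  then show ?thesis using Vc by (simp add: mult_smult_distrib[of _ n n _ n] mult_smult_assoc_mat[of _ n n _ n])
qed

text \<open>A two-sided inverse makes \<open>A\<close> a unit of the matrix ring, which excludes the
  result \<open>None\<close>; uniqueness of inverses does the rest.\<close>

lemma mat_inverse_unique:
  fixes A :: "'a :: field mat"
  assumes A: "A \<in> carrier_mat n n" and B: "B \<in> carrier_mat n n" and AB: "A * B = 1\<^sub>m n" "B * A = 1\<^sub>m n"
  shows "mat_inverse A = Some B"
proof (cases "mat_inverse A")
  case None
  have "A \<in> Units (ring_mat TYPE('a) n ())"
    using A B AB by (auto simp: Units_def ring_mat_def)
  with mat_inverse(1)[OF A None, of "()"] show ?thesis by simp
next
  case (Some C)
  then have C: "C * A = 1\<^sub>m n" "C \<in> carrier_mat n n" using mat_inverse(2)[OF A] by auto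
  have "C = C * (A * B)" using AB C by simp
  also have "\<dots> = C * A * B" by (rule assoc_mult_mat[symmetric, OF C(2) A B])
  finally show ?thesis using C B Some by simp
qed

locale svd =
  fixes n :: nat and B U V :: "real mat" and g :: "nat \<Rightarrow> real"
  assumes U: "is_orthogonal_matrix n U" and V: "is_orthogonal_matrix n V"
    and B: "B = U * mat_diag n g * transpose_mat V"
    and g_nonneg: "\<And>i. i < n \<Longrightarrow> 0 \<le> g i"
begin


lemma carriers: "U \<in> carrier_mat n n" "V \<in> carrier_mat n n" "B \<in> carrier_mat n n"
  using U V by (auto simp: is_orthogonal_matrix_def B)

text \<open>The columns of \<open>V\<close> diagonalise the regularised normal matrix with
  eigenvalues \<open>(g i)\<^sup>2 + \<alpha>\<close>. These are positive, so inversion is pointwise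
  on the diagonal.\<close>

lemma tikhonov_pos_svd:
  assumes "\<alpha> > 0"
  shows "tikhonov_pos B \<alpha> = V * mat_diag n (\<lambda>i. g i / ((g i)\<^sup>2 + \<alpha>)) * transpose_mat U"
proof -
  have BT: "transpose_mat B = V * mat_diag n g * transpose_mat U"
    unfolding B using carriers by (simp add: svd_product_transpose)
  have pos: "(g i)\<^sup>2 + \<alpha> > 0" for i using assms by (simp add: add_nonneg_pos)
  define A where "A = V * mat_diag n (\<lambda>i. (g i)\<^sup>2 + \<alpha>) * transpose_mat V"
  define C where "C = V * mat_diag n (\<lambda>i. 1 / ((g i)\<^sup>2 + \<alpha>)) * transpose_mat V"
  have "transpose_mat B * B + \<alpha> \<cdot>\<^sub>m 1\<^sub>m (dim_col B) = A"
  proof -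
    have "transpose_mat B * B = V * mat_diag n (\<lambda>i. (g i)\<^sup>2) * transpose_mat V"
      unfolding BT unfolding B using svd_product_mult[OF carriers(2) U carriers(2)]
      by (simp add: power2_eq_square)
    moreover have "\<alpha> \<cdot>\<^sub>m 1\<^sub>m (dim_col B) = V * mat_diag n (\<lambda>_. \<alpha>) * transpose_mat V"
      using carriers by (simp add: svd_product_const[OF V])
    ultimately show ?thesis using svd_product_add[OF carriers(2)] by (simp add: A_def)
  qed
  moreover have "mat_inverse A = Some C"
  proof (rule mat_inverse_unique)
    show "A \<in> carrier_mat n n" "C \<in> carrier_mat n n"
      unfolding A_def C_def using carriers by (auto intro!: svd_product_carrier)
    have "(\<lambda>i. ((g i)\<^sup>2 + \<alpha>) * (1 / ((g i)\<^sup>2 + \<alpha>))) = (\<lambda>_. 1)"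
       "(\<lambda>i. (1 / ((g i)\<^sup>2 + \<alpha>)) * ((g i)\<^sup>2 + \<alpha>)) = (\<lambda>_. 1)"
      using pos by (auto simp: fun_eq_iff less_imp_neq[symmetric])
    moreover have "1 \<cdot>\<^sub>m 1\<^sub>m n = (1\<^sub>m n :: real mat)" by auto
    ultimately show "A * C = 1\<^sub>m n" "C * A = 1\<^sub>m n"
      unfolding A_def C_def svd_product_mult[OF carriers(2) V carriers(2)]
      by (simp_all only: svd_product_const[OF V])
  qed
  ultimately have "tikhonov_pos B \<alpha> = C * transpose_mat B" by (simp add: tikhonov_pos_def)
  then show ?thesis
    unfolding C_def BT svd_product_mult[OF carriers(2) V carriers(1)] by simp
qed

text \<open>At \<open>\<alpha> = 0\<close> the convention \<open>0 / 0 = 0\<close> makes the quotient the diagonal of the pseudoinverse.\<close>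
lemma tikhonov_matrix_svd:
  assumes "\<alpha> \<ge> 0"
  shows "tikhonov_matrix B \<alpha> = V * mat_diag n (\<lambda>i. g i / ((g i)\<^sup>2 + \<alpha>)) * transpose_mat U"
proof (cases "\<alpha> = 0")
  case False
  with assms show ?thesis by (simp add: tikhonov_matrix_def tikhonov_pos_svd)
next
  case True
  show ?thesis
  proof (rule eq_matI)
    fix i j
    assume "i < dim_row (V * mat_diag n (\<lambda>i. g i / ((g i)\<^sup>2 + \<alpha>)) * transpose_mat U)"
      and "j < dim_col (V * mat_diag n (\<lambda>i. g i / ((g i)\<^sup>2 + \<alpha>)) * transpose_mat U)"
    then have ij: "i < n" "j < n" using carriers by auto
    \<comment> \<open>If \<open>g k\<close> vanishes, the quotient is identically 0 and agrees with
      the value 0 / 0 = 0 at the limit point; otherwise the denominator has a nonzero limit.\<close>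
    have "((\<lambda>\<beta>. g k / ((g k)\<^sup>2 + \<beta>)) \<longlongrightarrow> g k / ((g k)\<^sup>2 + 0)) (at_right 0)" for k
    proof (cases "g k = 0")
      case False
      then show ?thesis
        by (intro tendsto_divide tendsto_add tendsto_const tendsto_ident_at) auto
    qed simp
    then have "((\<lambda>\<beta>. \<Sum>k<n. V $$ (i, k) * (g k / ((g k)\<^sup>2 + \<beta>)) * U $$ (j, k)) \<longlongrightarrow>
        (\<Sum>k<n. V $$ (i, k) * (g k / ((g k)\<^sup>2 + 0)) * U $$ (j, k))) (at_right 0)"
      by (intro tendsto_sum tendsto_mult tendsto_const)
    moreover have "eventually (\<lambda>\<beta>. (\<Sum>k<n. V $$ (i, k) * (g k / ((g k)\<^sup>2 + \<beta>)) * U $$ (j, k))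
        = tikhonov_pos B \<beta> $$ (i, j)) (at_right 0)"
      unfolding eventually_at_right_field
      using ij carriers by (intro exI[of _ 1]) (simp add: tikhonov_pos_svd svd_product_index[of _ n] del: index_mult_mat(1))
    ultimately have "((\<lambda>\<beta>. tikhonov_pos B \<beta> $$ (i, j)) \<longlongrightarrow>
        (\<Sum>k<n. V $$ (i, k) * (g k / ((g k)\<^sup>2 + 0)) * U $$ (j, k))) (at_right 0)"
      by (rule Lim_transform_eventually)
    then have "Lim (at_right 0) (\<lambda>\<beta>. tikhonov_pos B \<beta> $$ (i, j))
       = (\<Sum>k<n. V $$ (i, k) * (g k / ((g k)\<^sup>2 + 0)) * U $$ (j, k))"
      by (intro tendsto_Lim) auto
    then show "tikhonov_matrix B \<alpha> $$ (i, j) = (V * mat_diag n (\<lambda>i. g i / ((g i)\<^sup>2 + \<alpha>)) * transpose_mat U) $$ (i, j)"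
      using ij carriers True by (simp add: tikhonov_matrix_def svd_product_index[of _ n] del: index_mult_mat(1))
  qed (use carriers True in \<open>auto simp: tikhonov_matrix_def\<close>)
qed

text \<open>The Tikhonov filter factors, i.e. the eigenvalues of the influence matrix. At \<alpha> =
  0 they are 1 on nonzero and 0 on zero singular values. Residual weights are written
  \<open>1 - filt \<alpha> i\<close> below, since
  \<open>\<alpha> / ((g i)\<^sup>2 + \<alpha>)\<close> would evaluate to 0 instead of its limit 1
  when \<alpha> and \<open>g i\<close> both vanish.\<close>

definition filt :: "real \<Rightarrow> nat \<Rightarrow> real" where
  "filt \<alpha> i = (g i)\<^sup>2 / ((g i)\<^sup>2 + \<alpha>)"

lemma influence_matrix_svd:
  assumes "\<alpha> \<ge> 0"
  shows "B * tikhonov_matrix B \<alpha> = U * mat_diag n (filt \<alpha>) * transpose_mat U"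
  unfolding tikhonov_matrix_svd[OF assms] unfolding B svd_product_mult[OF carriers(1) V carriers(1)]
  by (simp add: filt_def[abs_def] power2_eq_square)

section \<open>Norms, PSURE and the prediction error in singular coordinates\<close>

lemma sqnorm_sum: "v \<in> carrier_vec n \<Longrightarrow> sqnorm v = (\<Sum>i<n. (v $ i)\<^sup>2)"
  by (simp add: sqnorm_def scalar_prod_def lessThan_atLeast0 power2_eq_square)

text \<open>Parseval's identity in the orthonormal basis formed by the columns of
  \<open>W\<close>.\<close>

lemma sqnorm_transpose_mult:
  assumes W: "is_orthogonal_matrix n W" and v: "v \<in> carrier_vec n"
  shows "sqnorm v = (\<Sum>i<n. ((transpose_mat W *\<^sub>v v) $ i)\<^sup>2)"
proof -
  have Wc: "W \<in> carrier_mat n n" "W * transpose_mat W = 1\<^sub>m n" using W by (auto simp: is_orthogonal_matrix_def)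
  have "sqnorm (transpose_mat W *\<^sub>v v) = scalar_prod (transpose_mat W *\<^sub>v v) (transpose_mat W *\<^sub>v v)"
    by (simp add: sqnorm_def)
  also have "\<dots> = scalar_prod v (W *\<^sub>v (transpose_mat W *\<^sub>v v))"
    using Wc v by (intro transpose_vec_mult_scalar[of _ n n]) auto
  also have "W *\<^sub>v (transpose_mat W *\<^sub>v v) = (W * transpose_mat W) *\<^sub>v v"
    using Wc v by (intro assoc_mult_mat_vec[symmetric, of _ n n _ n]) auto
  also have "\<dots> = v" using Wc v by simp
  finally have "sqnorm v = sqnorm (transpose_mat W *\<^sub>v v)" by (simp add: sqnorm_def)
  then show ?thesis using Wc v by (simp add: sqnorm_sum)
qed

text \<open>Passing to coordinates along \<open>U\<close> cancels the left factor, and the diagonal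
  acts entrywise. The choice \<open>W = U\<close> serves the influence matrix, \<open>W = V\<close>
  the forward matrix \<open>B\<close>.\<close>

lemma transpose_svd_product_vec:
  assumes v: "v \<in> carrier_vec n" and W: "W \<in> carrier_mat n n" and "i < n"
  shows "(transpose_mat U *\<^sub>v ((U * mat_diag n f * transpose_mat W) *\<^sub>v v)) $ i = f i * (transpose_mat W *\<^sub>v v) $ i"
proof -
  have Uc: "U \<in> carrier_mat n n" "transpose_mat U * U = 1\<^sub>m n" using U by (auto simp: is_orthogonal_matrix_def)
  have T: "transpose_mat U \<in> carrier_mat n n" "transpose_mat W \<in> carrier_mat n n" using Uc W by auto
  have D: "mat_diag n f \<in> carrier_mat n n" by simp
  have w: "transpose_mat W *\<^sub>v v \<in> carrier_vec n" using T v by auto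
  have "transpose_mat U *\<^sub>v ((U * mat_diag n f * transpose_mat W) *\<^sub>v v)
     = (transpose_mat U * U) *\<^sub>v (mat_diag n f *\<^sub>v (transpose_mat W *\<^sub>v v))"
    using Uc(1) T D v w
    by (simp add: assoc_mult_mat_vec[of _ n n _ n] mult_mat_vec_carrier[of _ n n] mult_carrier_mat[of _ n n _ n])
  also have "\<dots> = mat_diag n f *\<^sub>v (transpose_mat W *\<^sub>v v)"
    unfolding Uc(2) by (intro one_mult_mat_vec mult_mat_vec_carrier[OF D w])
  also have "\<dots> $ i = (\<Sum>j<n. (if i = j then f j else 0) * (transpose_mat W *\<^sub>v v) $ j)"
    using \<open>i < n\<close> w W by (auto simp: mat_diag_def scalar_prod_def lessThan_atLeast0 intro!: sum.cong)
  also have "\<dots> = f i * (transpose_mat W *\<^sub>v v) $ i"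
    using \<open>i < n\<close> by (simp add: if_distrib[of "\<lambda>x. x * _"] cong: if_cong)
  finally show ?thesis .
qed

text \<open>The residual has coordinates \<open>1 - filt \<alpha> i\<close> times those of the data,
  and the trace is invariant under orthogonal conjugation.\<close>

lemma PSURE_svd:
  assumes "\<alpha> \<ge> 0" and y: "y \<in> carrier_vec n"
  shows "PSURE \<sigma> B \<alpha> y = (\<Sum>i<n. (1 - filt \<alpha> i)\<^sup>2 * ((transpose_mat U *\<^sub>v y) $ i)\<^sup>2)
    - real n * \<sigma>\<^sup>2 + 2 * \<sigma>\<^sup>2 * (\<Sum>i<n. filt \<alpha> i)"
proof -
  let ?H = "U * mat_diag n (filt \<alpha>) * transpose_mat U"
  have H: "?H \<in> carrier_mat n n" using carriers by (intro svd_product_carrier)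
  have T: "tikhonov_matrix B \<alpha> \<in> carrier_mat n n"
    unfolding tikhonov_matrix_svd[OF assms(1)] using carriers by (intro svd_product_carrier)
  have fit: "B *\<^sub>v tikhonov B \<alpha> y = ?H *\<^sub>v y"
    unfolding influence_matrix_svd[OF assms(1), symmetric] tikhonov_def
    using carriers(3) T y by (intro assoc_mult_mat_vec[symmetric])
  have "(transpose_mat U *\<^sub>v (y - ?H *\<^sub>v y)) $ i = (1 - filt \<alpha> i) * (transpose_mat U *\<^sub>v y) $ i" if "i < n" for i
    using transpose_svd_product_vec[OF y carriers(1) that, of "filt \<alpha>"] that carriers H y
    by (subst mult_minus_distrib_mat_vec[of _ n n]) (auto simp: algebra_simps)
  then have "sqnorm (y - B *\<^sub>v tikhonov B \<alpha> y) = (\<Sum>i<n. (1 - filt \<alpha> i)\<^sup>2 * ((transpose_mat U *\<^sub>v y) $ i)\<^sup>2)"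
    unfolding fit using H y by (subst sqnorm_transpose_mult[OF U]) (auto simp: power_mult_distrib)
  moreover have "mat_trace (B * tikhonov_matrix B \<alpha>) = (\<Sum>i<n. filt \<alpha> i)"
  proof -
    have "mat_trace ?H = (\<Sum>i<n. \<Sum>k<n. U $$ (i, k) * filt \<alpha> k * U $$ (i, k))"
      using carriers by (simp add: mat_trace_def svd_product_index[of _ n] del: index_mult_mat(1))
    also have "\<dots> = (\<Sum>k<n. filt \<alpha> k * (\<Sum>i<n. U $$ (i, k) * U $$ (i, k)))"
      by (subst sum.swap) (simp add: sum_distrib_left mult_ac)
    also have "\<dots> = (\<Sum>k<n. filt \<alpha> k)"
    proof (intro sum.cong refl)
      fix k assume "k \<in> {..<n}"
      then have "(\<Sum>i<n. U $$ (i, k) * U $$ (i, k)) = (transpose_mat U * U) $$ (k, k)"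
        using carriers by (simp add: scalar_prod_def lessThan_atLeast0)
      also have "\<dots> = 1" using U \<open>k \<in> {..<n}\<close> by (simp add: is_orthogonal_matrix_def del: index_mult_mat)
      finally show "filt \<alpha> k * (\<Sum>i<n. U $$ (i, k) * U $$ (i, k)) = filt \<alpha> k" by simp
    qed
    finally show ?thesis by (simp add: influence_matrix_svd[OF assms(1)])
  qed
  ultimately show ?thesis using carriers by (simp add: PSURE_def)
qed

lemma prediction_error_svd:
  assumes "\<alpha> \<ge> 0" and y: "y \<in> carrier_vec n" and x: "x \<in> carrier_vec n"
  shows "sqnorm (B *\<^sub>v (x - tikhonov B \<alpha> y))
    = (\<Sum>i<n. (g i * (transpose_mat V *\<^sub>v x) $ i - filt \<alpha> i * (transpose_mat U *\<^sub>v y) $ i)\<^sup>2)"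
proof -
  let ?H = "U * mat_diag n (filt \<alpha>) * transpose_mat U"
  have H: "?H \<in> carrier_mat n n" using carriers by (intro svd_product_carrier)
  have T: "tikhonov_matrix B \<alpha> \<in> carrier_mat n n"
    unfolding tikhonov_matrix_svd[OF assms(1)] using carriers by (intro svd_product_carrier)
  have fit: "B *\<^sub>v tikhonov B \<alpha> y = ?H *\<^sub>v y"
    unfolding influence_matrix_svd[OF assms(1), symmetric] tikhonov_def
    using carriers(3) T y by (intro assoc_mult_mat_vec[symmetric])
  have eq: "B *\<^sub>v (x - tikhonov B \<alpha> y) = B *\<^sub>v x - ?H *\<^sub>v y"
    unfolding fit[symmetric] using carriers(3) T x y
    by (intro mult_minus_distrib_mat_vec[of _ n n]) (auto simp: tikhonov_def)
  have "(transpose_mat U *\<^sub>v (B *\<^sub>v x - ?H *\<^sub>v y)) $ i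
    = g i * (transpose_mat V *\<^sub>v x) $ i - filt \<alpha> i * (transpose_mat U *\<^sub>v y) $ i" if "i < n" for i
    using transpose_svd_product_vec[OF y carriers(1) that, of "filt \<alpha>"]
      transpose_svd_product_vec[OF x carriers(2) that, of g, folded B] that carriers H y x
    by (subst mult_minus_distrib_mat_vec[of _ n n]) auto
  then show ?thesis
    unfolding eq using H y x carriers by (subst sqnorm_transpose_mult[OF U]) auto
qed

lemma transpose_data_svd:
  assumes x: "x \<in> carrier_vec n" and e: "e \<in> carrier_vec n" and i: "i < n"
  shows "(transpose_mat U *\<^sub>v (B *\<^sub>v x + e)) $ i = g i * (transpose_mat V *\<^sub>v x) $ i + (\<Sum>j<n. U $$ (j, i) * e $ j)"
proof -
  have "(transpose_mat U *\<^sub>v (B *\<^sub>v x + e)) = transpose_mat U *\<^sub>v (B *\<^sub>v x) + transpose_mat U *\<^sub>v e"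
    using carriers x e by (intro mult_add_distrib_mat_vec[of _ n n]) auto
  then show ?thesis
    using transpose_svd_product_vec[OF x carriers(2) i, of g, folded B] carriers i e
    by (simp add: scalar_prod_def lessThan_atLeast0)
qed

end

section \<open>Suprema and stochastic order\<close>

text \<open>The positive rationals are dense in the closed half-line, with 0 as a limit point, so
  continuity carries any upper bound over to all points. A countable supremum is what measurability
  requires.\<close>

lemma cSUP_atLeast_eq_rational:
  fixes f :: "real \<Rightarrow> real"
  assumes cont: "continuous_on {0..} f" and bdd: "bdd_above (f ` {0..})"
  shows "(SUP a\<in>{0..}. f a) = (SUP a\<in>{0<..} \<inter> \<rat>. f a)"
proof -
  have "1 \<in> {0::real<..} \<inter> \<rat>" by simp
  then have ne: "{0::real<..} \<inter> \<rat> \<noteq> {}" by blast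
  have cl: "closure ({0<..} \<inter> \<rat>) = {0::real..}"
    by (subst closure_open_Int_superset) (auto simp: Rats_closure_real)
  have bdd': "bdd_above (f ` ({0<..} \<inter> \<rat>))"
    by (rule bdd_above_mono[OF bdd]) auto
  show ?thesis
  proof (rule antisym)
    show "(SUP a\<in>{0..}. f a) \<le> (SUP a\<in>{0<..} \<inter> \<rat>. f a)"
    proof (rule cSUP_least)
      fix a :: real assume "a \<in> {0..}"
      show "f a \<le> (SUP a\<in>{0<..} \<inter> \<rat>. f a)"
      proof (rule continuous_le_on_closure[where S = "{0<..} \<inter> \<rat>" and f = f and x = a])
        show "f b \<le> (SUP a\<in>{0<..} \<inter> \<rat>. f a)" if "b \<in> {0<..} \<inter> \<rat>" for b
          using that by (rule cSUP_upper[OF _ bdd'])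
      qed (use cont \<open>a \<in> {0..}\<close> in \<open>simp_all add: cl\<close>)
    qed auto
    show "(SUP a\<in>{0<..} \<inter> \<rat>. f a) \<le> (SUP a\<in>{0..}. f a)"
      using ne by (intro cSUP_subset_mono bdd) auto
  qed
qed

text \<open>Chebyshev's inequality bounds the exceedance probability by \<open>K / T\<^sup>2\<close>
  for all large \<open>m\<close>. This bound does not involve \<open>m\<close>, so it survives the
  limsup and tends to 0 as \<open>T\<close> grows.\<close>

lemma bigO_prob_if_second_moment_le:
  assumes P: "\<And>m. m \<ge> 1 \<Longrightarrow> prob_space (P m)"
    and Z: "\<And>m. m \<ge> 1 \<Longrightarrow> Z m \<in> borel_measurable (P m)"
    and int: "\<And>m. m \<ge> 1 \<Longrightarrow> integrable (P m) (\<lambda>\<omega>. (Z m \<omega>)\<^sup>2)"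
    and r: "\<And>m. m \<ge> 1 \<Longrightarrow> r m > 0"
    and le: "eventually (\<lambda>m. (LINT \<omega>|P m. (Z m \<omega>)\<^sup>2) \<le> K * (r m)\<^sup>2) sequentially"
  shows "bigO_prob P Z r"
proof -
  define L where "L = (\<lambda>T. limsup (\<lambda>m. ereal (measure (P m) {\<omega> \<in> space (P m). \<bar>Z m \<omega>\<bar> > T * r m})))"
  have up: "L T \<le> ereal (K / T\<^sup>2)" if T: "T > 0" for T
    unfolding L_def
  proof (rule Limsup_bounded)
    show "eventually (\<lambda>m. ereal (measure (P m) {\<omega> \<in> space (P m). \<bar>Z m \<omega>\<bar> > T * r m}) \<le> ereal (K / T\<^sup>2)) sequentially"
      using le eventually_ge_at_top[of 1]
    proof eventually_elim
      case (elim m)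
      interpret prob_space "P m" by (rule P[OF elim(2)])
      note [measurable] = Z[OF elim(2)]
      let ?A = "{\<omega> \<in> space (P m). \<bar>Z m \<omega>\<bar> > T * r m}"
      have A: "?A \<in> sets (P m)" by measurable
      have "(T * r m)\<^sup>2 * measure (P m) ?A = (LINT \<omega>|P m. (T * r m)\<^sup>2 * indicator ?A \<omega>)"
        using A by simp
      also have "\<dots> \<le> (LINT \<omega>|P m. (Z m \<omega>)\<^sup>2)"
      proof (rule integral_mono)
        show "integrable (P m) (\<lambda>\<omega>. (T * r m)\<^sup>2 * indicator ?A \<omega>)"
          using A by (auto simp: emeasure_eq_measure)
        show "(T * r m)\<^sup>2 * indicator ?A \<omega> \<le> (Z m \<omega>)\<^sup>2" for \<omega>
        proof (cases "\<omega> \<in> ?A")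
          case True
          then have "\<bar>T * r m\<bar> \<le> \<bar>Z m \<omega>\<bar>" using T r[OF elim(2)] by simp
          then show ?thesis using True by (simp add: abs_le_square_iff)
        qed simp
      qed (rule int[OF elim(2)])
      finally have "(T * r m)\<^sup>2 * measure (P m) ?A \<le> K * (r m)\<^sup>2" using elim(1) by simp
      then have "T\<^sup>2 * measure (P m) ?A \<le> K"
        using r[OF elim(2)] by (simp add: power_mult_distrib mult.commute mult.left_commute)
      then show ?case using T by (simp add: field_simps)
    qed
  qed
  have lo: "0 \<le> L T" for T
    unfolding L_def by (rule le_Limsup) (auto intro!: always_eventually)
  have "((\<lambda>T. K / T\<^sup>2) \<longlongrightarrow> 0) at_top"
    by (intro tendsto_divide_0[OF tendsto_const] filterlim_at_top_imp_at_infinity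
        filterlim_pow_at_top filterlim_ident) auto
  then have K0: "((\<lambda>T. ereal (K / T\<^sup>2)) \<longlongrightarrow> 0) at_top"
    by (simp add: zero_ereal_def)
  have "eventually (\<lambda>T. L T \<le> ereal (K / T\<^sup>2)) at_top"
    using eventually_gt_at_top[of 0] by (rule eventually_mono) (rule up)
  then have "(L \<longlongrightarrow> 0) at_top"
    by (intro tendsto_sandwich[OF _ _ tendsto_const K0]) (simp_all add: lo)
  then show ?thesis by (simp add: bigO_prob_def L_def)
qed

section \<open>The risk gap\<close>

context svd
begin

lemma filt_bounds:
  assumes "\<alpha> \<ge> 0"
  shows "0 \<le> filt \<alpha> i" "filt \<alpha> i \<le> 1"
proof -
  \<comment> \<open>The denominator can vanish only when \<alpha> and \<open>g i\<close> both do,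
    and then the quotient is 0 by convention.\<close>
  have "(g i)\<^sup>2 + \<alpha> = 0 \<or> 0 < (g i)\<^sup>2 + \<alpha>"
    using assms by (auto simp: less_le)
  then show "0 \<le> filt \<alpha> i" "filt \<alpha> i \<le> 1"
    using assms by (auto simp: filt_def)
qed

text \<open>For fixed \<alpha>, the map t / (t + \<alpha>) is nondecreasing in t. As the singular
  values decrease, the residual weights therefore increase with the index.\<close>

lemma filt_mono:
  assumes "\<alpha> \<ge> 0" and "g j \<le> g i" and "j < n"
  shows "filt \<alpha> j \<le> filt \<alpha> i"
proof (cases "g j = 0")
  case True
  then show ?thesis using filt_bounds(1)[OF \<open>\<alpha> \<ge> 0\<close>, of i] by (simp add: filt_def[of _ j])
next
  case False
  then have gj: "0 < g j" using g_nonneg[OF \<open>j < n\<close>] by simp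
  have sq: "(g j)\<^sup>2 \<le> (g i)\<^sup>2" using gj assms by (intro power_mono) auto
  have pos: "0 < (g j)\<^sup>2 + \<alpha>" "0 < (g i)\<^sup>2 + \<alpha>" using gj assms by (auto intro!: add_pos_nonneg)
  have "(g j)\<^sup>2 * ((g i)\<^sup>2 + \<alpha>) \<le> (g i)\<^sup>2 * ((g j)\<^sup>2 + \<alpha>)"
    using mult_right_mono[OF sq \<open>\<alpha> \<ge> 0\<close>] by (simp add: algebra_simps)
  then show ?thesis using pos by (simp add: filt_def divide_le_eq le_divide_eq mult.commute)
qed

text \<open>For a vanishing singular value the filter factor is identically 0, so there is no jump
  at \<alpha> = 0.\<close>

lemma filt_continuous: "continuous_on {0..} (\<lambda>\<alpha>. filt \<alpha> i)"
proof (cases "g i = 0")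
  case False
  then have "(g i)\<^sup>2 + \<alpha> \<noteq> 0" if "\<alpha> \<ge> 0" for \<alpha>
    using that zero_less_power2[of "g i"] by linarith
  then show ?thesis unfolding filt_def by (intro continuous_intros) auto
qed (simp add: filt_def)

end

section \<open>The noisy model in rotated coordinates\<close>

locale noisy_svd = svd n B U V g + prob_space P
  for n B U V g and P :: "'w measure" +
  fixes \<sigma> :: real and x :: "real Matrix.vec" and e y :: "'w \<Rightarrow> real Matrix.vec"
  assumes n: "n \<ge> 1" and \<sigma>: "\<sigma> > 0"
    and g_decreasing: "\<And>i j. i \<le> j \<Longrightarrow> j < n \<Longrightarrow> g j \<le> g i"
    and g_le_1: "g 0 \<le> 1"
    and x: "x \<in> carrier_vec n"
    and noise: "white_noise P n \<sigma> e"
    and y: "\<And>\<omega>. \<omega> \<in> space P \<Longrightarrow> y \<omega> = B *\<^sub>v x + e \<omega>"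
begin

definition signal :: "nat \<Rightarrow> real" where
  "signal i = g i * (transpose_mat V *\<^sub>v x) $ i"

definition rot :: "nat \<Rightarrow> 'w \<Rightarrow> real" where
  "rot i \<omega> = (\<Sum>j<n. U $$ (j, i) * e \<omega> $ j)"

text \<open>The squared data coordinate \<open>(signal i + rot i \<omega>)\<^sup>2\<close> minus its
  mean; free of \<alpha>.\<close>

definition incr :: "nat \<Rightarrow> 'w \<Rightarrow> real" where
  "incr i \<omega> = 2 * signal i * rot i \<omega> + ((rot i \<omega>)\<^sup>2 - \<sigma>\<^sup>2)"

lemma e_carrier: "\<omega> \<in> space P \<Longrightarrow> e \<omega> \<in> carrier_vec n"
  using noise by (simp add: white_noise_def)

lemma y_carrier: "\<omega> \<in> space P \<Longrightarrow> y \<omega> \<in> carrier_vec n"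
  using y e_carrier carriers x by simp

lemma rot_iid:
  shows "indep_vars (\<lambda>_. borel) rot {..<n}"
    and "i < n \<Longrightarrow> distributed P lborel (rot i) (\<lambda>t. ennreal (normal_density 0 \<sigma> t))"
proof -
  have orth: "(\<Sum>j<n. U $$ (j, i) * U $$ (j, k)) = (if i = k then 1 else 0)" if "i < n" "k < n" for i k
  proof -
    have "(\<Sum>j<n. U $$ (j, i) * U $$ (j, k)) = (transpose_mat U * U) $$ (i, k)"
      using carriers that by (simp add: scalar_prod_def lessThan_atLeast0)
    also have "\<dots> = (1\<^sub>m n) $$ (i, k)" using U by (simp only: is_orthogonal_matrix_def)
    finally show ?thesis using that by simp
  qed
  have ind: "indep_vars (\<lambda>_. borel) (\<lambda>i \<omega>. e \<omega> $ i) {..<n}"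
    and dist: "\<And>i. i < n \<Longrightarrow> distributed P lborel (\<lambda>\<omega>. e \<omega> $ i) (\<lambda>t. ennreal (normal_density 0 \<sigma> t))"
    using noise by (simp_all add: white_noise_def)
  note * = normal_rotation[where a = "\<lambda>i j. U $$ (j, i)", OF ind dist \<sigma> orth]
  show "indep_vars (\<lambda>_. borel) rot {..<n}"
    using *(1) unfolding rot_def[abs_def] by simp
  show "distributed P lborel (rot i) (\<lambda>t. ennreal (normal_density 0 \<sigma> t))" if "i < n"
    using *(2)[of i] that unfolding rot_def[abs_def] by simp
qed

lemma rotated_data:
  "\<omega> \<in> space P \<Longrightarrow> i < n \<Longrightarrow> (transpose_mat U *\<^sub>v y \<omega>) $ i = signal i + rot i \<omega>"
  by (simp add: y transpose_data_svd[OF x e_carrier] signal_def rot_def)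

text \<open>Bias-variance decomposition: the error in coordinate \<open>i\<close> is \<open>(1 -
  filt \<alpha> i) * signal i - filt \<alpha> i * rot i \<omega>\<close>, and the cross term has
  mean zero.\<close>

lemma MSPE_svd:
  assumes "\<alpha> \<ge> 0"
  shows "MSPE P B x y \<alpha> = (\<Sum>i<n. (1 - filt \<alpha> i)\<^sup>2 * (signal i)\<^sup>2 + (filt \<alpha> i)\<^sup>2 * \<sigma>\<^sup>2)"
proof -
  have int: "integrable P (rot i)" "integrable P (\<lambda>\<omega>. (rot i \<omega>)\<^sup>2)" and
    E: "expectation (rot i) = 0" "expectation (\<lambda>\<omega>. (rot i \<omega>)\<^sup>2) = \<sigma>\<^sup>2" if "i < n" for i
    using normal_moments(1)[OF rot_iid(2)[OF that] \<sigma>, of 1]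
      normal_moments(1)[OF rot_iid(2)[OF that] \<sigma>, of 2]
      normal_moments(3)[OF rot_iid(2)[OF that] \<sigma>, of 0]
      normal_moments(2)[OF rot_iid(2)[OF that] \<sigma>, of 1]
    by (simp_all add: power2_eq_square)
  have "MSPE P B x y \<alpha> = expectation (\<lambda>\<omega>. \<Sum>i<n. (1 - filt \<alpha> i)\<^sup>2 * (signal i)\<^sup>2
      + (- 2 * (1 - filt \<alpha> i) * filt \<alpha> i * signal i) * rot i \<omega> + (filt \<alpha> i)\<^sup>2 * (rot i \<omega>)\<^sup>2)"
    unfolding MSPE_def
  proof (intro Bochner_Integration.integral_cong refl)
    fix \<omega> assume \<omega>: "\<omega> \<in> space P"
    have "sqnorm (B *\<^sub>v (x - tikhonov B \<alpha> (y \<omega>))) = (\<Sum>i<n. (signal i - filt \<alpha> i * (signal i + rot i \<omega>))\<^sup>2)"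
      unfolding prediction_error_svd[OF assms y_carrier[OF \<omega>] x]
      by (intro sum.cong refl) (simp add: rotated_data[OF \<omega>] signal_def)
    also have "\<dots> = (\<Sum>i<n. (1 - filt \<alpha> i)\<^sup>2 * (signal i)\<^sup>2
      + (- 2 * (1 - filt \<alpha> i) * filt \<alpha> i * signal i) * rot i \<omega> + (filt \<alpha> i)\<^sup>2 * (rot i \<omega>)\<^sup>2)"
      by (intro sum.cong refl) (simp add: power2_eq_square algebra_simps)
    finally show "sqnorm (B *\<^sub>v (x - tikhonov B \<alpha> (y \<omega>))) = \<dots>" .
  qed
  also have "\<dots> = (\<Sum>i<n. expectation (\<lambda>\<omega>. (1 - filt \<alpha> i)\<^sup>2 * (signal i)\<^sup>2
      + (- 2 * (1 - filt \<alpha> i) * filt \<alpha> i * signal i) * rot i \<omega> + (filt \<alpha> i)\<^sup>2 * (rot i \<omega>)\<^sup>2))"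
    using int by (intro Bochner_Integration.integral_sum Bochner_Integration.integrable_add integrable_mult_right) auto
  also have "\<dots> = (\<Sum>i<n. (1 - filt \<alpha> i)\<^sup>2 * (signal i)\<^sup>2 + (filt \<alpha> i)\<^sup>2 * \<sigma>\<^sup>2)"
    by (intro sum.cong refl) (simp add: int E prob_space)
  finally show ?thesis .
qed

text \<open>The constants combine to
  \<open>- 1 + 2 * filt \<alpha> i - (filt \<alpha> i)\<^sup>2\<close>, that is
  \<open>- (1 - filt \<alpha> i)\<^sup>2\<close>, times the noise variance. So each centred
  increment carries exactly the squared residual weight.\<close>

lemma PSURE_minus_MSPE:
  assumes "\<alpha> \<ge> 0" and \<omega>: "\<omega> \<in> space P"
  shows "PSURE \<sigma> B \<alpha> (y \<omega>) - MSPE P B x y \<alpha> = (\<Sum>i<n. (1 - filt \<alpha> i)\<^sup>2 * incr i \<omega>)"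
proof -
  have "PSURE \<sigma> B \<alpha> (y \<omega>) = (\<Sum>i<n. (1 - filt \<alpha> i)\<^sup>2 * (signal i + rot i \<omega>)\<^sup>2)
      - (\<Sum>i<n. \<sigma>\<^sup>2) + (\<Sum>i<n. 2 * \<sigma>\<^sup>2 * filt \<alpha> i)"
    by (simp add: PSURE_svd[OF assms(1) y_carrier[OF \<omega>]] rotated_data[OF \<omega>] sum_distrib_left)
  then have "PSURE \<sigma> B \<alpha> (y \<omega>) - MSPE P B x y \<alpha> = (\<Sum>i<n. (1 - filt \<alpha> i)\<^sup>2 * (signal i + rot i \<omega>)\<^sup>2
      - \<sigma>\<^sup>2 + 2 * \<sigma>\<^sup>2 * filt \<alpha> i - ((1 - filt \<alpha> i)\<^sup>2 * (signal i)\<^sup>2 + (filt \<alpha> i)\<^sup>2 * \<sigma>\<^sup>2))"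
    by (simp only: MSPE_svd[OF assms(1)] sum_subtractf sum.distrib)
  also have "\<dots> = (\<Sum>i<n. (1 - filt \<alpha> i)\<^sup>2 * incr i \<omega>)"
    by (intro sum.cong refl) (simp add: incr_def power2_eq_square algebra_simps)
  finally show ?thesis .
qed

lemma risk_gap_eq:
  assumes "\<alpha> \<ge> 0" and "\<omega> \<in> space P"
  shows "risk_gap P n \<sigma> B x y \<alpha> \<omega> = \<bar>\<Sum>i<n. (1 - filt \<alpha> i)\<^sup>2 * incr i \<omega>\<bar> / real n"
  by (simp add: risk_gap_def PSURE_minus_MSPE[OF assms] abs_mult)

text \<open>The squared residual weights increase with the index and lie in [0, 1], so Abel
  summation gives a bound independent of \<alpha>.\<close>

lemma risk_gap_le:
  assumes "\<alpha> \<ge> 0" and "\<omega> \<in> space P"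
  shows "risk_gap P n \<sigma> B x y \<alpha> \<omega> \<le> 2 * partial_max (\<lambda>i. incr i \<omega>) n / real n"
proof -
  have "\<bar>\<Sum>i<n. (1 - filt \<alpha> i)\<^sup>2 * incr i \<omega>\<bar> \<le> 2 * partial_max (\<lambda>i. incr i \<omega>) n"
  proof (rule Abel_summation_bound)
    show "(1 - filt \<alpha> i)\<^sup>2 \<le> (1 - filt \<alpha> j)\<^sup>2" if "i \<le> j" "j < n" for i j
      using filt_mono[OF assms(1) g_decreasing[OF that] that(2)] filt_bounds[OF assms(1)]
      by (intro power_mono) auto
    show "(1 - filt \<alpha> i)\<^sup>2 \<le> 1" for i
      using filt_bounds[OF assms(1), of i] by (intro power_le_one) auto
  qed (auto intro: partial_max_ge)
  then show ?thesis by (simp add: risk_gap_eq[OF assms] divide_right_mono)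
qed

lemma bdd_above_risk_gap:
  "\<omega> \<in> space P \<Longrightarrow> bdd_above ((\<lambda>\<alpha>. risk_gap P n \<sigma> B x y \<alpha> \<omega>) ` {0..})"
  by (rule bdd_aboveI2[where M = "2 * partial_max (\<lambda>i. incr i \<omega>) n / real n"]) (auto intro: risk_gap_le)

lemma rot_measurable: "i < n \<Longrightarrow> rot i \<in> borel_measurable P"
  using rot_iid(2) by (simp add: distributed_def)

lemma incr_measurable: "i < n \<Longrightarrow> incr i \<in> borel_measurable P"
  unfolding incr_def[abs_def] by (auto dest: rot_measurable)

lemma sup_risk_gap_measurable: "sup_risk_gap P n \<sigma> B x y \<in> borel_measurable P"
proof -
  have "sup_risk_gap P n \<sigma> B x y \<omega> = (SUP \<alpha>\<in>{0<..} \<inter> \<rat>. risk_gap P n \<sigma> B x y \<alpha> \<omega>)"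
    if \<omega>: "\<omega> \<in> space P" for \<omega>
    unfolding sup_risk_gap_def
  proof (rule cSUP_atLeast_eq_rational[OF _ bdd_above_risk_gap[OF \<omega>]])
    have "continuous_on {0..} (\<lambda>\<alpha>. \<bar>\<Sum>i<n. (1 - filt \<alpha> i)\<^sup>2 * incr i \<omega>\<bar> / real n)"
      using n by (intro continuous_intros filt_continuous) auto
    then show "continuous_on {0..} (\<lambda>\<alpha>. risk_gap P n \<sigma> B x y \<alpha> \<omega>)"
      by (rule continuous_on_eq) (simp add: risk_gap_eq[OF _ \<omega>])
  qed
  moreover have "(\<lambda>\<omega>. SUP \<alpha>\<in>{0<..} \<inter> \<rat>. risk_gap P n \<sigma> B x y \<alpha> \<omega>) \<in> borel_measurable P"
  proof (rule borel_measurable_cSUP)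
    show "countable ({0<..} \<inter> \<rat> :: real set)" by (simp add: countable_rat)
    fix \<alpha> :: real assume \<alpha>: "\<alpha> \<in> {0<..} \<inter> \<rat>"
    have "(\<lambda>\<omega>. \<bar>\<Sum>i<n. (1 - filt \<alpha> i)\<^sup>2 * incr i \<omega>\<bar> / real n) \<in> borel_measurable P"
      by (intro borel_measurable_divide borel_measurable_abs borel_measurable_sum borel_measurable_times
          borel_measurable_const incr_measurable) auto
    then show "risk_gap P n \<sigma> B x y \<alpha> \<in> borel_measurable P"
      by (rule measurable_cong[THEN iffD1, rotated]) (use \<alpha> in \<open>simp add: risk_gap_eq\<close>)
  next
    fix \<omega> assume "\<omega> \<in> space P"
    then show "bdd_above ((\<lambda>\<alpha>. risk_gap P n \<sigma> B x y \<alpha> \<omega>) ` ({0<..} \<inter> \<rat>))"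
      by (rule bdd_above_mono[OF bdd_above_risk_gap]) auto
  qed
  ultimately show ?thesis by (simp cong: measurable_cong)
qed

lemma sup_risk_gap_sq_le:
  assumes \<omega>: "\<omega> \<in> space P"
  shows "(sup_risk_gap P n \<sigma> B x y \<omega>)\<^sup>2 \<le> 4 / (real n)\<^sup>2 * (partial_max (\<lambda>i. incr i \<omega>) n)\<^sup>2"
proof -
  have "sup_risk_gap P n \<sigma> B x y \<omega> \<le> 2 * partial_max (\<lambda>i. incr i \<omega>) n / real n"
    unfolding sup_risk_gap_def by (rule cSUP_least) (auto intro: risk_gap_le[OF _ \<omega>])
  \<comment> \<open>Nonnegativity, witnessed at \<alpha> = 0, permits squaring the upper
    bound.\<close>
  moreover have "0 \<le> sup_risk_gap P n \<sigma> B x y \<omega>"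
    unfolding sup_risk_gap_def
    by (rule cSUP_upper2[OF bdd_above_risk_gap[OF \<omega>], of 0]) (auto simp: risk_gap_def)
  ultimately have "(sup_risk_gap P n \<sigma> B x y \<omega>)\<^sup>2 \<le> (2 * partial_max (\<lambda>i. incr i \<omega>) n / real n)\<^sup>2"
    by (rule power_mono)
  then show ?thesis by (simp add: power_divide power_mult_distrib)
qed

text \<open>Each variance is
  \<open>4 * \<sigma>\<^sup>2 * (signal i)\<^sup>2 + 2 * \<sigma> ^ 4\<close>. Doob's inequality
  contributes a factor 4 and the squared Abel factor another 4, hence 64 and 32.\<close>

lemma sup_risk_gap_second_moment:
  shows "integrable P (\<lambda>\<omega>. (sup_risk_gap P n \<sigma> B x y \<omega>)\<^sup>2)"
    and "(LINT \<omega>|P. (sup_risk_gap P n \<sigma> B x y \<omega>)\<^sup>2)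
      \<le> (64 * \<sigma>\<^sup>2 * sqnorm x + 32 * \<sigma> ^ 4 * real n) / (real n)\<^sup>2"
proof -
  have ind: "indep_vars (\<lambda>_. borel) incr {..<n}"
    unfolding incr_def[abs_def] by (rule indep_vars_compose2[OF rot_iid(1)]) auto
  have mean: "expectation (incr i) = 0"
    and sq: "integrable P (\<lambda>\<omega>. (incr i \<omega>)\<^sup>2)"
    and var: "expectation (\<lambda>\<omega>. (incr i \<omega>)\<^sup>2) = 4 * \<sigma>\<^sup>2 * (signal i)\<^sup>2 + 2 * \<sigma> ^ 4" if "i < n" for i
    using normal_quadratic_moments[OF rot_iid(2)[OF that] \<sigma>, of "2 * signal i" 1]
    by (simp_all add: incr_def[abs_def] power_mult_distrib)
  note D = Kolmogorov_Doob_L2[OF ind sq mean]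
  have int: "integrable P (\<lambda>\<omega>. 4 / (real n)\<^sup>2 * (partial_max (\<lambda>i. incr i \<omega>) n)\<^sup>2)"
    using D(1) by simp
  show I: "integrable P (\<lambda>\<omega>. (sup_risk_gap P n \<sigma> B x y \<omega>)\<^sup>2)"
  proof (rule Bochner_Integration.integrable_bound[OF int])
    show "(\<lambda>\<omega>. (sup_risk_gap P n \<sigma> B x y \<omega>)\<^sup>2) \<in> borel_measurable P"
      using sup_risk_gap_measurable by simp
    show "AE \<omega> in P. norm ((sup_risk_gap P n \<sigma> B x y \<omega>)\<^sup>2)
        \<le> norm (4 / (real n)\<^sup>2 * (partial_max (\<lambda>i. incr i \<omega>) n)\<^sup>2)"
      by (rule AE_I2) (use sup_risk_gap_sq_le in simp)
  qed
  \<comment> \<open>All singular values are at most \<open>g 0\<close>, hence at most 1, so applying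
    \<open>B\<close> does not increase the energy of the signal.\<close>
  have "(\<Sum>i<n. (signal i)\<^sup>2) \<le> (\<Sum>i<n. ((transpose_mat V *\<^sub>v x) $ i)\<^sup>2)"
  proof (rule sum_mono)
    fix i assume "i \<in> {..<n}"
    then have "0 \<le> g i" "g i \<le> 1" using g_nonneg g_decreasing[of 0 i] g_le_1 by auto
    then have "(g i)\<^sup>2 \<le> 1" by (simp add: power_le_one)
    then show "(signal i)\<^sup>2 \<le> ((transpose_mat V *\<^sub>v x) $ i)\<^sup>2"
      unfolding signal_def power_mult_distrib by (simp add: mult_left_le_one_le)
  qed
  then have "(\<Sum>i<n. (signal i)\<^sup>2) \<le> sqnorm x" by (simp add: sqnorm_transpose_mult[OF V x])
  then have le: "4 * \<sigma>\<^sup>2 * (\<Sum>i<n. (signal i)\<^sup>2) \<le> 4 * \<sigma>\<^sup>2 * sqnorm x"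
    by (intro mult_left_mono) auto
  have "(LINT \<omega>|P. (sup_risk_gap P n \<sigma> B x y \<omega>)\<^sup>2)
      \<le> (LINT \<omega>|P. 4 / (real n)\<^sup>2 * (partial_max (\<lambda>i. incr i \<omega>) n)\<^sup>2)"
    by (rule integral_mono[OF I int sup_risk_gap_sq_le])
  also have "\<dots> \<le> 4 / (real n)\<^sup>2 * (4 * (\<Sum>i<n. expectation (\<lambda>\<omega>. (incr i \<omega>)\<^sup>2)))"
    unfolding integral_mult_right_zero by (intro mult_left_mono D(2)) auto
  also have "(\<Sum>i<n. expectation (\<lambda>\<omega>. (incr i \<omega>)\<^sup>2)) = 4 * \<sigma>\<^sup>2 * (\<Sum>i<n. (signal i)\<^sup>2) + 2 * \<sigma> ^ 4 * real n"
    by (simp add: var sum.distrib sum_distrib_left)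
  also have "4 / (real n)\<^sup>2 * (4 * (4 * \<sigma>\<^sup>2 * (\<Sum>i<n. (signal i)\<^sup>2) + 2 * \<sigma> ^ 4 * real n))
    \<le> 4 / (real n)\<^sup>2 * (4 * (4 * \<sigma>\<^sup>2 * sqnorm x + 2 * \<sigma> ^ 4 * real n))"
    using le by (intro mult_left_mono) auto
  also have "\<dots> = (64 * \<sigma>\<^sup>2 * sqnorm x + 32 * \<sigma> ^ 4 * real n) / (real n)\<^sup>2"
    by (simp add: field_simps)
  finally show "(LINT \<omega>|P. (sup_risk_gap P n \<sigma> B x y \<omega>)\<^sup>2)
      \<le> (64 * \<sigma>\<^sup>2 * sqnorm x + 32 * \<sigma> ^ 4 * real n) / (real n)\<^sup>2" .
qed

end

section \<open>From bounds at fixed dimension to the asymptotic statement\<close>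

theorem theorem2:
  fixes P :: "nat \<Rightarrow> 'w measure"
    and A :: "nat \<Rightarrow> real Matrix.mat"
    and x :: "nat \<Rightarrow> real Matrix.vec"
    and \<epsilon> y :: "nat \<Rightarrow> 'w \<Rightarrow> real Matrix.vec"
    and \<gamma> :: "nat \<Rightarrow> nat \<Rightarrow> real"
    and \<sigma> :: real
  assumes "\<sigma> > 0"
    and "\<And>m. m \<ge> 1 \<Longrightarrow> prob_space (P m)"
    and "\<And>m. m \<ge> 1 \<Longrightarrow> A m \<in> carrier_mat m m"
    and "\<And>m. m \<ge> 1 \<Longrightarrow> x m \<in> carrier_vec m"
    and "\<And>m. m \<ge> 1 \<Longrightarrow> white_noise (P m) m \<sigma> (\<epsilon> m)"
    and "\<And>m \<omega>. m \<ge> 1 \<Longrightarrow> \<omega> \<in> space (P m) \<Longrightarrow> y m \<omega> = A m *\<^sub>v x m + \<epsilon> m \<omega>"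
    and "\<And>m. m \<ge> 1 \<Longrightarrow> singular_values m (A m) (\<gamma> m)"
    and "\<And>m. m \<ge> 1 \<Longrightarrow> \<gamma> m 0 = 1"
    and "(\<lambda>m. sqnorm (x m)) \<in> O(\<lambda>m. real m)"
  shows "let Z = (\<lambda>m. sup_risk_gap (P m) m \<sigma> (A m) (x m) (y m)) in
    (\<forall>m\<ge>1.
       (\<forall>\<omega>\<in>space (P m).
          bdd_above ((\<lambda>\<alpha>. risk_gap (P m) m \<sigma> (A m) (x m) (y m) \<alpha> \<omega>) ` {0..})) \<and>
       Z m \<in> borel_measurable (P m) \<and>
       integrable (P m) (\<lambda>\<omega>. (Z m \<omega>)\<^sup>2)) \<and>
    bigO_prob P Z (\<lambda>m. 1 / sqrt (real m)) \<and>
    (\<lambda>m. LINT \<omega>|P m. (Z m \<omega>)\<^sup>2) \<in> O(\<lambda>m. 1 / real m)"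
proof -
  define Z where "Z = (\<lambda>m. sup_risk_gap (P m) m \<sigma> (A m) (x m) (y m))"
  \<comment> \<open>The decomposition is chosen for each \<open>m\<close> separately; the facts
    drawn from it below do not mention \<open>U\<close> or \<open>V\<close>.\<close>
  have model: "\<exists>U V. noisy_svd m (A m) U V (\<gamma> m) (P m) \<sigma> (x m) (\<epsilon> m) (y m)" if m: "m \<ge> 1" for m
  proof -
    have sv: "singular_values m (A m) (\<gamma> m)" using assms(7) m .
    from sv[unfolded singular_values_def, THEN conjunct1] obtain U V where UV: "is_orthogonal_matrix m U" "is_orthogonal_matrix m V"
      "A m = U * mat_diag m (\<gamma> m) * transpose_mat V"
      by (elim exE conjE)
    have "svd m (A m) U V (\<gamma> m)"
      using UV sv by unfold_locales (auto simp: singular_values_def)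
    moreover have "noisy_svd_axioms m (A m) (\<gamma> m) (P m) \<sigma> (x m) (\<epsilon> m) (y m)"
    proof
      show "\<gamma> m j \<le> \<gamma> m i" if "i \<le> j" "j < m" for i j
        using sv that by (simp add: singular_values_def)
      show "\<gamma> m 0 \<le> 1" using assms(8)[OF m] by simp
    qed (fact m assms(1) assms(4)[OF m] assms(5)[OF m] assms(6)[OF m])+
    ultimately have "noisy_svd m (A m) U V (\<gamma> m) (P m) \<sigma> (x m) (\<epsilon> m) (y m)"
      using assms(2)[OF m] by (intro noisy_svd.intro)
    then show ?thesis by blast
  qed
  have basic: "(\<forall>\<omega>\<in>space (P m). bdd_above ((\<lambda>\<alpha>. risk_gap (P m) m \<sigma> (A m) (x m) (y m) \<alpha> \<omega>) ` {0..})) \<and>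
      Z m \<in> borel_measurable (P m) \<and> integrable (P m) (\<lambda>\<omega>. (Z m \<omega>)\<^sup>2)"
    and moment: "(LINT \<omega>|P m. (Z m \<omega>)\<^sup>2)
      \<le> (64 * \<sigma>\<^sup>2 * sqnorm (x m) + 32 * \<sigma> ^ 4 * real m) / (real m)\<^sup>2" if m: "m \<ge> 1" for m
  proof -
    from model[OF m] obtain U V where "noisy_svd m (A m) U V (\<gamma> m) (P m) \<sigma> (x m) (\<epsilon> m) (y m)" by blast
    then interpret noisy_svd m "A m" U V "\<gamma> m" "P m" \<sigma> "x m" "\<epsilon> m" "y m" .
    show "(\<forall>\<omega>\<in>space (P m). bdd_above ((\<lambda>\<alpha>. risk_gap (P m) m \<sigma> (A m) (x m) (y m) \<alpha> \<omega>) ` {0..})) \<and>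
      Z m \<in> borel_measurable (P m) \<and> integrable (P m) (\<lambda>\<omega>. (Z m \<omega>)\<^sup>2)"
      using bdd_above_risk_gap sup_risk_gap_measurable sup_risk_gap_second_moment(1) by (simp add: Z_def)
    show "(LINT \<omega>|P m. (Z m \<omega>)\<^sup>2) \<le> (64 * \<sigma>\<^sup>2 * sqnorm (x m) + 32 * \<sigma> ^ 4 * real m) / (real m)\<^sup>2"
      using sup_risk_gap_second_moment(2) by (simp add: Z_def)
  qed
  obtain c where c: "eventually (\<lambda>m. norm (sqnorm (x m)) \<le> c * norm (real m)) sequentially"
    using assms(9) by (auto elim: landau_o.bigE)
  \<comment> \<open>\<open>c\<close> bounds the squared norm of the signal per dimension, so the
    numerator of the moment bound is at most \<open>K * real m\<close>, and division by
    \<open>(real m)\<^sup>2\<close> leaves the rate \<open>1 / real m\<close>.\<close>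
  define K where "K = 64 * \<sigma>\<^sup>2 * c + 32 * \<sigma> ^ 4"
  have rate: "eventually (\<lambda>m. (LINT \<omega>|P m. (Z m \<omega>)\<^sup>2) \<le> K * (1 / real m)) sequentially"
    using c eventually_ge_at_top[of 1]
  proof eventually_elim
    case (elim m)
    have "64 * \<sigma>\<^sup>2 * sqnorm (x m) \<le> 64 * \<sigma>\<^sup>2 * (c * real m)"
      using elim by (intro mult_left_mono) auto
    then have "(64 * \<sigma>\<^sup>2 * sqnorm (x m) + 32 * \<sigma> ^ 4 * real m) / (real m)\<^sup>2 \<le> (K * real m) / (real m)\<^sup>2"
      by (intro divide_right_mono) (auto simp: K_def algebra_simps)
    also have "\<dots> = K * (1 / real m)" using elim by (simp add: power2_eq_square)
    finally show ?case using moment[OF elim(2)] by simp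
  qed
  have "bigO_prob P Z (\<lambda>m. 1 / sqrt (real m))"
  proof (rule bigO_prob_if_second_moment_le)
    show "eventually (\<lambda>m. (LINT \<omega>|P m. (Z m \<omega>)\<^sup>2) \<le> K * (1 / sqrt (real m))\<^sup>2) sequentially"
      using rate by (simp add: power_divide)
  qed (use assms(2) basic in auto)
  moreover have "(\<lambda>m. LINT \<omega>|P m. (Z m \<omega>)\<^sup>2) \<in> O(\<lambda>m. 1 / real m)"
    by (rule bigoI[where c = K]) (use rate in \<open>auto elim!: eventually_mono\<close>)
  ultimately show ?thesis using basic unfolding Let_def Z_def by blast
qed

end
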